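(* Let $K$ be a field, $S=K[x_1,\ldots,x_n]$ the polynomial ring with the standard grading, and $A=K[x_1,\ldots,x_n,y_1,\ldots,y_m]$ with the bigrading $\deg x_i=(1,0)$ and $\deg y_j=(p_j,1)$ for some integers $p_j\ge 0$. Let $a,b\in\mathbb{Z}$. For $k\gg 0$, the higher iterated Hilbert coefficients $e^i_j(A(-a,-b)_k)$ are polynomial functions of degree $m+j-1$ with $$e^i_j(A(-a,-b)_k)\le\binom{k-b+m-1}{m-1}\binom{p_m(k-b)+a}{j}.$$ Equality holds, if and only if $p_1=p_2=\cdots=p_m$ for all $j$.
   Context: $A(-a,-b)$ is the bigraded $A$-module with components $A(-a,-b)_{(i,j)}=A_{(i-a,j-b)}$, and for a finitely generated bigraded $A$-module $M=\bigoplus_{i,j\in\mathbb{Z}}M_{(i,j)}$, $M_k$ denotes the graded $S$-module $\bigoplus_{i\in\mathbb{Z}}M_{(i,k)}$. The polynomial functions in the claim are functions of $k$. For a finitely generated graded $S$-module $W$ of Krull dimension $d$, put $H_0(W,k)=\dim_K W_k$ (here $W_k$ is the degree $k$ component of $W$) and recursively $H_i(W,k)=\sum_{j\le k}H_{i-1}(W,j)$ for $i\ge 1$. For $k\gg 0$ one has $H_i(W,k)=P^i_W(k)$ for a unique polynomial $P^i_W(x)\in\mathbb{Q}[x]$ of degree $d+i-1$, written $$P^i_W(x)=\sum_{j=0}^{d+i-1}(-1)^j e^i_j(W)\binom{x+d+i-j-1}{d+i-j-1}.$$ The integers $e^i_j(W)$, $0\le j\le d+i-1$, are the higher iterated Hilbert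 coefficients of $W$. Binomial coefficients are $\binom{r}{j}=\frac{r(r-1)\cdots(r-j+1)}{j(j-1)\cdots 2\cdot 1}$ for $j>0$ and $\binom{r}{0}=1$.
   Formalization: Assumes p_m is the largest p_j (else the bound fails, e.g. p=(1,0), a=b=0, j=1); exact degree m+j-1 is claimed only if p_m>0 or j=0 (if all p_j=0 and j≥1 it is false), otherwise degree at most m+j-1; the equality criterion for each single j is stated for j≥1, as equality always holds at j=0. *)

theory Defs
  imports
    Complex_Main
    "HOL-Library.Poly_Mapping"
    "HOL-Library.Extended_Nat"
    "HOL-Library.Cardinality"
    "HOL-Computational_Algebra.Polynomial"
begin

text \<open>
  The polynomial ring over \<open>'k\<close> in variables indexed by \<open>'v\<close> is the monoid algebra of the
  additive monoid of exponent vectors; the ring operations are those of the type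
  \<open>\<Rightarrow>\<^sub>0\<close> (multiplication is convolution).
\<close>

type_synonym ('v, 'k) mpol = "('v \<Rightarrow>\<^sub>0 nat) \<Rightarrow>\<^sub>0 'k"

definition const_pol :: "'k \<Rightarrow> ('v, 'k::zero) mpol" where
  "const_pol c = Poly_Mapping.single 0 c"

text \<open>
  With \<open>S = ('n, 'k) mpol\<close> and \<open>A = ('n + 'm, 'k) mpol\<close>, the variable \<open>Inl r\<close> of \<open>A\<close> is
  \<open>x\<^sub>r\<close> and \<open>Inr s\<close> is \<open>y\<^sub>s\<close>. The following is the inclusion of \<open>S\<close> in \<open>A\<close>.
\<close>

definition incl_exponent :: "('n \<Rightarrow>\<^sub>0 nat) \<Rightarrow> ('n + 'm \<Rightarrow>\<^sub>0 nat)" where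
  "incl_exponent t = (\<Sum>r\<in>Poly_Mapping.keys t. Poly_Mapping.single (Inl r) (Poly_Mapping.lookup t r))"

definition incl_pol :: "('n, 'k::comm_ring_1) mpol \<Rightarrow> ('n + 'm, 'k) mpol" where
  "incl_pol f = (\<Sum>t\<in>Poly_Mapping.keys f. Poly_Mapping.single (incl_exponent t) (Poly_Mapping.lookup f t))"

definition prime_ideal :: "'r::comm_ring_1 set \<Rightarrow> bool" where
  "prime_ideal P \<longleftrightarrow> module.subspace (*) P \<and> P \<noteq> UNIV \<and>
     (\<forall>x y. x * y \<in> P \<longrightarrow> x \<in> P \<or> y \<in> P)"

definition annihilator :: "('r::comm_ring_1 \<Rightarrow> 'b::ab_group_add \<Rightarrow> 'b) \<Rightarrow> 'b set \<Rightarrow> 'r set" where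
  "annihilator scale N = {r. \<forall>w\<in>N. scale r w = 0}"

text \<open>
  The Krull dimension of a module \<open>N\<close> is that of the ring modulo the annihilator of \<open>N\<close>, i.e.
  the supremum of the lengths of chains of prime ideals containing the annihilator. (The zero
  module, which has no such chain, gets the value 0 here.)
\<close>

definition krull_dim :: "('r::comm_ring_1 \<Rightarrow> 'b::ab_group_add \<Rightarrow> 'b) \<Rightarrow> 'b set \<Rightarrow> enat" where
  "krull_dim scale N = Sup {enat l | l. \<exists>P :: nat \<Rightarrow> 'r set.
     (\<forall>i\<le>l. prime_ideal (P i) \<and> annihilator scale N \<subseteq> P i) \<and> (\<forall>i<l. P i \<subset> P (Suc i))}"

text \<open>
  A graded \<open>S\<close>-module is given by the action \<open>scale\<close> of \<open>S\<close> on an ambient abelian group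
  together with the family \<open>W\<close> of its homogeneous components; its underlying
  module is their (internal) direct sum.
\<close>

definition total_module :: "(int \<Rightarrow> 'b::ab_group_add set) \<Rightarrow> 'b set" where
  "total_module W = {(\<Sum>i\<in>I. w i) | I w. finite I \<and> (\<forall>i\<in>I. w i \<in> W i)}"

text \<open>
  The set \<open>{..k}\<close> of integers is infinite, so the sum has to be restricted to the support, which is
  finite below \<open>k\<close> for a finitely generated module.
\<close>

primrec iterated_hilbert ::
  "(('v, 'k::field) mpol \<Rightarrow> 'b::ab_group_add \<Rightarrow> 'b) \<Rightarrow> (int \<Rightarrow> 'b set) \<Rightarrow> nat \<Rightarrow> int \<Rightarrow> nat" where
  "iterated_hilbert scale W 0 = (\<lambda>k. vector_space.dim (\<lambda>c. scale (const_pol c)) (W k))"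
| "iterated_hilbert scale W (Suc i) =
     (\<lambda>k. \<Sum>j | j \<le> k \<and> iterated_hilbert scale W i j \<noteq> 0. iterated_hilbert scale W i j)"

definition iterated_hilbert_poly ::
  "(('v, 'k::field) mpol \<Rightarrow> 'b::ab_group_add \<Rightarrow> 'b) \<Rightarrow> (int \<Rightarrow> 'b set) \<Rightarrow> nat \<Rightarrow> rat poly" where
  "iterated_hilbert_poly scale W i =
     (THE P. \<forall>\<^sub>F k in at_top. of_nat (iterated_hilbert scale W i k) = poly P (of_int k))"

text \<open>
  The coefficient sequence is extended by zero beyond the index \<open>d + i - 1\<close>, so that it is unique.
\<close>

definition iterated_hilbert_coeff ::
  "(('v, 'k::field) mpol \<Rightarrow> 'b::ab_group_add \<Rightarrow> 'b) \<Rightarrow> (int \<Rightarrow> 'b set) \<Rightarrow> nat \<Rightarrow> nat \<Rightarrow> int" where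
  "iterated_hilbert_coeff scale W i =
     (let d = the_enat (krull_dim scale (total_module W)) in
      THE e :: nat \<Rightarrow> int. (\<forall>j\<ge>d + i. e j = 0) \<and>
        (\<forall>x :: rat. poly (iterated_hilbert_poly scale W i) x =
           (\<Sum>j<d + i. (-1) ^ j * of_int (e j) *
              ((x + of_nat (d + i - j - 1)) gchoose (d + i - j - 1)))))"

definition bideg :: "('m \<Rightarrow> nat) \<Rightarrow> ('n::finite + 'm::finite \<Rightarrow>\<^sub>0 nat) \<Rightarrow> int \<times> int" where
  "bideg p t =
     (int ((\<Sum>r\<in>UNIV. Poly_Mapping.lookup t (Inl r)) + (\<Sum>s\<in>UNIV. p s * Poly_Mapping.lookup t (Inr s))),
      int (\<Sum>s\<in>UNIV. Poly_Mapping.lookup t (Inr s)))"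

definition A_comp :: "('m \<Rightarrow> nat) \<Rightarrow> int \<Rightarrow> int \<Rightarrow> ('n::finite + 'm::finite, 'k::field) mpol set" where
  "A_comp p i j = {f. \<forall>t\<in>Poly_Mapping.keys f. bideg p t = (i, j)}"

text \<open>
  A bigraded \<open>A\<close>-module is given by an action of \<open>A\<close> and the family \<open>M\<close> of its components.
  The module \<open>M(-a,-b)\<close> has the same action and shifted components; its strand \<open>M\<^sub>k\<close> is a graded
  module over \<open>S\<close> via the inclusion of \<open>S\<close> in \<open>A\<close>.
\<close>

definition bi_twist :: "int \<Rightarrow> int \<Rightarrow> (int \<Rightarrow> int \<Rightarrow> 'b set) \<Rightarrow> int \<Rightarrow> int \<Rightarrow> 'b set" where
  "bi_twist a b M i j = M (i - a) (j - b)"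

definition strand :: "(int \<Rightarrow> int \<Rightarrow> 'b set) \<Rightarrow> int \<Rightarrow> int \<Rightarrow> 'b set" where
  "strand M k i = M i k"

definition restrict_scalars ::
  "(('n + 'm, 'k::comm_ring_1) mpol \<Rightarrow> 'b \<Rightarrow> 'b) \<Rightarrow> ('n, 'k) mpol \<Rightarrow> 'b \<Rightarrow> 'b" where
  "restrict_scalars scale f w = scale (incl_pol f) w"

end

theory Submission
  imports Defs "HOL-Computational_Algebra.Formal_Power_Series"
begin

text \<open>
  Put \<open>K = k - b\<close> and let \<open>\<beta>\<close> run over the \<open>m\<close>-tuples of natural numbers with sum \<open>K\<close>; write
  \<open>p \<cdot> \<beta>\<close> for \<open>\<Sum>s. p s * \<beta> s\<close>. The monomials \<open>y\<^sup>\<beta>\<close> form an \<open>S\<close>-basis of the part of \<open>A\<close> of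
  \<open>y\<close>-degree \<open>K\<close>, so \<open>A(-a,-b)\<^sub>k\<close> is the direct sum of the free modules \<open>S(-(a + p \<cdot> \<beta>))\<close>. Summing
  the Hilbert function of \<open>S\<close> up \<open>i\<close> times gives that of a polynomial ring in \<open>q = n + i\<close> variables,
  so each summand \<open>S(-c)\<close> contributes \<open>x - c + q - 1\<close> choose \<open>q - 1\<close> to the iterated Hilbert
  polynomial. By Vandermonde's identity the \<open>j\<close>-th coefficient of this contribution, in the basis that
  defines the iterated Hilbert coefficients, is \<open>c\<close> choose \<open>j\<close>. Hence \<open>e\<^sup>i\<^sub>j(A(-a,-b)\<^sub>k)\<close> is the sum of
  the numbers \<open>a + p \<cdot> \<beta>\<close> choose \<open>j\<close> over all \<open>\<beta>\<close>, independently of \<open>i\<close>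
  (\<open>iterated_hilbert_coeff_strand\<close>), and all claims are read off this formula.

  Polynomiality and degree: removing one \<open>y\<close>-variable, or one unit of the exponent of that variable,
  expresses the first difference in \<open>K\<close> of the sum by sums with fewer variables or smaller \<open>j\<close>
  (\<open>weighted_binomial_sum_Suc\<close>). By induction the difference of order \<open>m + j - 1\<close> is constant, and the
  constant is nonnegative, and positive if \<open>j = 0\<close> or some weight is positive
  (\<open>const_diff_weighted_binomial_sum\<close>).

  Bound and equality: there are \<open>K + m - 1\<close> choose \<open>m - 1\<close> tuples \<open>\<beta>\<close>, each with
  \<open>p \<cdot> \<beta> \<le> p\<^sub>m * K\<close>. If \<open>K\<close> is large, then \<open>c\<close> choose \<open>j\<close> with \<open>a \<le> c < p\<^sub>m * K + a\<close> and \<open>j \<ge> 1\<close> is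
  strictly below its value at \<open>p\<^sub>m * K + a\<close>, even where \<open>c\<close> is negative
  (\<open>gbinomial_of_int_strict_less\<close>). So equality forces \<open>p \<cdot> \<beta> = p\<^sub>m * K\<close> for all \<open>\<beta>\<close>, and
  concentrating \<open>\<beta>\<close> at one place shows that all weights agree.

  The iterated Hilbert coefficients refer to the Krull dimension of the strand, which is that of \<open>S\<close>
  because a nonzero free module is faithful. That it equals \<open>n\<close> is shown directly: given a chain
  \<open>P 0 \<subset> \<dots> \<subset> P l\<close> of prime ideals, elements \<open>x i\<close> of \<open>P (i + 1)\<close> outside \<open>P i\<close> are algebraically
  independent (\<open>prime_chain_separating_independent\<close>), and counting monomials in the \<open>x i\<close> yields
  \<open>l \<le> n\<close>; the ideals generated by increasing sets of variables form a chain of length \<open>n\<close>.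
\<close>

section \<open>Sums of binomial coefficients over weak compositions\<close>

text \<open>
  The exponent vectors \<open>\<beta>\<close> of the introduction, for a variable set \<open>X\<close> and \<open>y\<close>-degree \<open>K\<close>. They are
  total functions that vanish outside \<open>X\<close>, so that a set \<open>X\<close> can be enlarged in an induction without
  changing the type of the vectors.
\<close>

definition compositions :: "'s set \<Rightarrow> nat \<Rightarrow> ('s \<Rightarrow> nat) set" where
  "compositions X K = {\<beta>. (\<forall>s. s \<notin> X \<longrightarrow> \<beta> s = 0) \<and> (\<Sum>s\<in>X. \<beta> s) = K}"

lemma finite_compositions:
  assumes "finite X"
  shows "finite (compositions X K)"
proof -
  have "compositions X K \<subseteq> {\<beta>. \<forall>s. (s \<in> X \<longrightarrow> \<beta> s \<in> {..K}) \<and> (s \<notin> X \<longrightarrow> \<beta> s = 0)}"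
    using assms by (auto simp: compositions_def intro: member_le_sum)
  then show ?thesis
    using finite_set_of_finite_funs[OF assms, of "{..K}" 0] by (auto intro: finite_subset)
qed

lemma compositions_empty: "compositions {} K = (if K = 0 then {\<lambda>_. 0} else {})"
  by (auto simp: compositions_def)

lemma compositions_zero:
  assumes "finite X"
  shows "compositions X 0 = {\<lambda>_. 0}"
  using assms by (auto simp: compositions_def)

text \<open>
  A vector either vanishes at the new place \<open>s\<close> or arises by adding one unit there. Both the count of
  the vectors and the recursion for the weighted binomial sums come from this dichotomy.
\<close>

lemma compositions_insert_Suc:
  assumes "finite X" "s \<notin> X"
  shows "compositions (insert s X) (Suc K) =
    compositions X (Suc K) \<union> (\<lambda>\<beta>. \<beta>(s := Suc (\<beta> s))) ` compositions (insert s X) K"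
proof (intro equalityI subsetI)
  fix \<beta> assume b: "\<beta> \<in> compositions (insert s X) (Suc K)"
  show "\<beta> \<in> compositions X (Suc K) \<union> (\<lambda>\<beta>. \<beta>(s := Suc (\<beta> s))) ` compositions (insert s X) K"
  proof (cases "\<beta> s")
    case 0
    then have "\<beta> \<in> compositions X (Suc K)" using b assms by (simp add: compositions_def) metis
    then show ?thesis by blast
  next
    case (Suc l)
    have "(\<Sum>t\<in>X. (\<beta>(s := l)) t) = (\<Sum>t\<in>X. \<beta> t)"
      using assms by (intro sum.cong) auto
    then have "\<beta>(s := l) \<in> compositions (insert s X) K"
      using b assms Suc by (auto simp: compositions_def)
    moreover have "\<beta> = (\<lambda>\<beta>. \<beta>(s := Suc (\<beta> s))) (\<beta>(s := l))"
      using Suc by auto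
    ultimately show ?thesis by blast
  qed
next
  fix \<beta> assume "\<beta> \<in> compositions X (Suc K) \<union> (\<lambda>\<beta>. \<beta>(s := Suc (\<beta> s))) ` compositions (insert s X) K"
  then show "\<beta> \<in> compositions (insert s X) (Suc K)"
  proof
    assume "\<beta> \<in> compositions X (Suc K)"
    then show ?thesis using assms by (auto simp: compositions_def)
  next
    assume "\<beta> \<in> (\<lambda>\<beta>. \<beta>(s := Suc (\<beta> s))) ` compositions (insert s X) K"
    then obtain \<gamma> where g: "\<gamma> \<in> compositions (insert s X) K" and \<beta>: "\<beta> = \<gamma>(s := Suc (\<gamma> s))" by blast
    have "(\<Sum>t\<in>X. \<beta> t) = (\<Sum>t\<in>X. \<gamma> t)"
      using assms \<beta> by (intro sum.cong) auto
    then show ?thesis using g \<beta> assms by (auto simp: compositions_def)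
  qed
qed

lemma sum_compositions_insert_Suc:
  fixes g :: "('s \<Rightarrow> nat) \<Rightarrow> 'c::comm_monoid_add"
  assumes "finite X" "s \<notin> X"
  shows "(\<Sum>\<beta>\<in>compositions (insert s X) (Suc K). g \<beta>) =
    (\<Sum>\<beta>\<in>compositions X (Suc K). g \<beta>) +
    (\<Sum>\<beta>\<in>compositions (insert s X) K. g (\<beta>(s := Suc (\<beta> s))))"
proof -
  let ?b = "\<lambda>\<beta>::'s \<Rightarrow> nat. \<beta>(s := Suc (\<beta> s))"
  have inj: "inj_on ?b (compositions (insert s X) K)"
  proof (rule inj_onI)
    fix \<beta> \<gamma> :: "'s \<Rightarrow> nat" assume eq: "?b \<beta> = ?b \<gamma>"
    show "\<beta> = \<gamma>"
    proof
      fix t show "\<beta> t = \<gamma> t" using fun_cong[OF eq, of t] by (cases "t = s") auto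
    qed
  qed
  have disj: "compositions X (Suc K) \<inter> ?b ` compositions (insert s X) K = {}"
    using assms by (auto simp: compositions_def)
  show ?thesis
    unfolding compositions_insert_Suc[OF assms]
    using assms disj inj by (subst sum.union_disjoint) (auto simp: finite_compositions sum.reindex)
qed

lemma card_compositions:
  assumes "finite X" "X \<noteq> {}"
  shows "card (compositions X K) = (K + card X - 1) choose (card X - 1)"
  using assms
proof (induction X arbitrary: K rule: finite_ne_induct)
  case (singleton s)
  have "compositions {s} K = {(\<lambda>_. 0)(s := K)}"
    by (auto simp: compositions_def)
  then show ?case by simp
next
  case (insert s X)
  from insert.hyps obtain x where x: "card X = Suc x"
    by (metis card_gt_0_iff gr0_implies_Suc)
  show ?case
  proof (induction K)
    case 0
    show ?case using insert.hyps by (simp add: compositions_zero)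
  next
    case (Suc K)
    have "card (compositions (insert s X) (Suc K)) =
        card (compositions X (Suc K)) + card (compositions (insert s X) K)"
      using sum_compositions_insert_Suc[of X s "\<lambda>_. 1::nat" K] insert.hyps by simp
    then show ?case
      using Suc insert.IH[of "Suc K"] insert.hyps x by simp
  qed
qed

definition weighted_binomial_sum :: "('s \<Rightarrow> nat) \<Rightarrow> 's set \<Rightarrow> rat \<Rightarrow> nat \<Rightarrow> nat \<Rightarrow> rat" where
  "weighted_binomial_sum p X c j K =
     (\<Sum>\<beta>\<in>compositions X K. (c + of_nat (\<Sum>s\<in>X. p s * \<beta> s)) gchoose j)"

text \<open>
  Adding one unit to \<open>\<beta> s\<close> raises the weight of \<open>\<beta>\<close> by \<open>p s\<close>; Vandermonde's identity trades this
  shift for smaller values of \<open>j\<close> with the same offset \<open>c\<close>. The term \<open>u = 0\<close> is the sum itself at \<open>K\<close>,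
  so the identity determines the first difference in \<open>K\<close>.
\<close>

lemma weighted_binomial_sum_Suc:
  assumes "finite X" "s \<notin> X"
  shows "weighted_binomial_sum p (insert s X) c j (Suc K) =
    weighted_binomial_sum p X c j (Suc K) +
    (\<Sum>u\<le>j. (of_nat (p s) gchoose u) * weighted_binomial_sum p (insert s X) c (j - u) K)"
proof -
  have A: "(\<Sum>\<beta>\<in>compositions X (Suc K). (c + of_nat (\<Sum>t\<in>insert s X. p t * \<beta> t)) gchoose j) =
      weighted_binomial_sum p X c j (Suc K)"
    using assms unfolding weighted_binomial_sum_def
    by (intro sum.cong) (auto simp: compositions_def)
  have B: "(c + of_nat (\<Sum>t\<in>insert s X. p t * (\<beta>(s := Suc (\<beta> s))) t)) gchoose j =
     (\<Sum>u\<le>j. (of_nat (p s) gchoose u) * ((c + of_nat (\<Sum>t\<in>insert s X. p t * \<beta> t)) gchoose (j - u)))"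
    for \<beta> :: "'a \<Rightarrow> nat"
  proof -
    have "(\<Sum>t\<in>X. p t * (\<beta>(s := Suc (\<beta> s))) t) = (\<Sum>t\<in>X. p t * \<beta> t)"
      using assms by (intro sum.cong) auto
    then have "c + of_nat (\<Sum>t\<in>insert s X. p t * (\<beta>(s := Suc (\<beta> s))) t) =
        of_nat (p s) + (c + of_nat (\<Sum>t\<in>insert s X. p t * \<beta> t))"
      using assms by (simp add: algebra_simps)
    then show ?thesis
      using gbinomial_Vandermonde[of "of_nat (p s)" "c + of_nat (\<Sum>t\<in>insert s X. p t * \<beta> t)" j]
      by (simp only: atLeast0AtMost)
  qed
  show ?thesis
    unfolding weighted_binomial_sum_def[of p "insert s X"] sum_compositions_insert_Suc[OF assms] A B
    by (subst sum.swap) (simp add: sum_distrib_left)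
qed

lemma weighted_binomial_sum_0:
  assumes "finite X" "X \<noteq> {}"
  shows "weighted_binomial_sum p X c 0 K = of_nat ((K + card X - 1) choose (card X - 1))"
  using card_compositions[OF assms, of K] by (simp add: weighted_binomial_sum_def)

section \<open>Functions with a constant iterated difference\<close>

definition diff_op :: "(nat \<Rightarrow> rat) \<Rightarrow> nat \<Rightarrow> rat" where
  "diff_op f = (\<lambda>K. f (Suc K) - f K)"

text \<open>
  This says that \<open>f\<close> is a polynomial function of degree at most \<open>d\<close> whose coefficient of degree \<open>d\<close>,
  multiplied by the factorial of \<open>d\<close>, is \<open>L\<close>. In this normalisation taking a difference lowers \<open>d\<close>
  and keeps \<open>L\<close>.
\<close>

definition const_diff :: "nat \<Rightarrow> rat \<Rightarrow> (nat \<Rightarrow> rat) \<Rightarrow> bool" where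
  "const_diff d L f \<longleftrightarrow> (\<forall>K. (diff_op ^^ d) f K = L)"

lemma const_diff_0: "const_diff 0 L f \<longleftrightarrow> (\<forall>K. f K = L)"
  by (simp add: const_diff_def)

lemma const_diff_Suc: "const_diff (Suc d) L f \<longleftrightarrow> const_diff d L (diff_op f)"
  by (simp add: const_diff_def funpow_Suc_right del: funpow.simps)

lemma const_diff_add:
  "const_diff d L f \<Longrightarrow> const_diff d M g \<Longrightarrow> const_diff d (L + M) (\<lambda>K. f K + g K)"
proof (induction d arbitrary: f g)
  case (Suc d)
  have "diff_op (\<lambda>K. f K + g K) = (\<lambda>K. diff_op f K + diff_op g K)"
    by (auto simp: diff_op_def)
  then show ?case using Suc by (simp add: const_diff_Suc)
qed (simp add: const_diff_0)

lemma const_diff_mult: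
  "const_diff d L f \<Longrightarrow> const_diff d (a * L) (\<lambda>K. a * f K)"
proof (induction d arbitrary: f)
  case (Suc d)
  have "diff_op (\<lambda>K. a * f K) = (\<lambda>K. a * diff_op f K)"
    by (simp add: diff_op_def algebra_simps)
  then show ?case using Suc by (simp add: const_diff_Suc)
qed (simp add: const_diff_0)

lemma const_diff_zero: "const_diff d 0 (\<lambda>_. 0)"
proof (induction d)
  case (Suc d)
  then show ?case by (simp add: const_diff_Suc diff_op_def)
qed (simp add: const_diff_0)

lemma const_diff_sum:
  assumes "\<And>u. u \<in> U \<Longrightarrow> const_diff d (L u) (f u)"
  shows "const_diff d (\<Sum>u\<in>U. L u) (\<lambda>K. \<Sum>u\<in>U. f u K)"
  using assms
  by (induction U rule: infinite_finite_induct) (auto simp: const_diff_zero const_diff_add)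

lemma const_diff_shift:
  "const_diff d L f \<Longrightarrow> const_diff d L (\<lambda>K. f (Suc K))"
proof (induction d arbitrary: f)
  case (Suc d)
  have "diff_op (\<lambda>K. f (Suc K)) = (\<lambda>K. diff_op f (Suc K))"
    by (simp add: diff_op_def)
  then show ?case using Suc by (simp add: const_diff_Suc)
qed (simp add: const_diff_0)

lemma const_diff_raise:
  assumes "const_diff d L f" "d < d'"
  shows "const_diff d' 0 f"
proof -
  have "const_diff (Suc d + k) 0 f" for k
  proof (induction k)
    case 0
    show ?case using assms(1) by (simp add: const_diff_def diff_op_def)
  next
    case (Suc k)
    then show ?case by (simp add: const_diff_def diff_op_def)
  qed
  from this[of "d' - Suc d"] show ?thesis using assms(2) by simp
qed

text \<open>
  Newton's forward difference formula; the coefficient \<open>c l\<close> is the \<open>l\<close>-th difference of \<open>f\<close> at \<open>0\<close>.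
\<close>

lemma const_diff_newton:
  assumes "const_diff d L f"
  shows "\<exists>c. c d = L \<and> (\<forall>K. f K = (\<Sum>l\<le>d. c l * of_nat (K choose l)))"
  using assms
proof (induction d arbitrary: f)
  case 0
  then show ?case by (auto simp: const_diff_0)
next
  case (Suc d)
  then obtain c where c: "c d = L" "\<And>K. diff_op f K = (\<Sum>l\<le>d. c l * of_nat (K choose l))"
    unfolding const_diff_Suc by blast
  define c' where "c' = case_nat (f 0) c"
  have "f K = (\<Sum>l\<le>Suc d. c' l * of_nat (K choose l))" for K
  proof (induction K)
    case 0
    show ?case unfolding sum.atMost_Suc_shift by (simp add: c'_def)
  next
    case (Suc K)
    have "f (Suc K) = f K + diff_op f K" by (simp add: diff_op_def)
    also have "\<dots> = f 0 + (\<Sum>l\<le>d. c l * of_nat (K choose Suc l)) + (\<Sum>l\<le>d. c l * of_nat (K choose l))"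
      unfolding Suc c(2) sum.atMost_Suc_shift by (simp add: c'_def)
    also have "\<dots> = (\<Sum>l\<le>Suc d. c' l * of_nat (Suc K choose l))"
      unfolding sum.atMost_Suc_shift by (simp add: c'_def sum.distrib algebra_simps)
    finally show ?case .
  qed
  moreover have "c' (Suc d) = L" using c(1) by (simp add: c'_def)
  ultimately show ?case by blast
qed

lemma gbinomial_poly:
  "\<exists>B :: rat poly. degree B = l \<and> coeff B l > 0 \<and> (\<forall>x. poly B x = x gchoose l)"
proof (induction l)
  case 0
  show ?case by (intro exI[of _ 1]) simp
next
  case (Suc l)
  then obtain B :: "rat poly" where B: "degree B = l" "coeff B l > 0" "\<And>x. poly B x = x gchoose l"
    by blast
  define C where "C = smult (1 / of_nat (Suc l)) (B * [:- of_nat l, 1:])"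
  have "B \<noteq> 0" using B(2) by auto
  then have deg: "degree C = Suc l" unfolding C_def
    using B(1) by (simp add: degree_mult_eq del: mult_pCons_right)
  have "lead_coeff C = lead_coeff B / of_nat (Suc l)"
    unfolding C_def by (simp add: lead_coeff_mult del: mult_pCons_right)
  then have "coeff C (Suc l) > 0" using deg B by simp
  moreover have "poly C x = x gchoose Suc l" for x
  proof -
    have "of_nat (Suc l) * (x gchoose Suc l) = (x gchoose l) * (x - of_nat l)"
      using gbinomial_absorb_comp[of x l] gbinomial_absorption[of l "x"]
      by (simp add: gbinomial_mult_1 algebra_simps)
    then show ?thesis unfolding C_def by (simp add: B(3) field_simps)
  qed
  ultimately show ?case using deg by blast
qed

lemma const_diff_imp_poly:
  assumes "const_diff d L f"
  shows "\<exists>Q :: rat poly. degree Q \<le> d \<and> (L > 0 \<longrightarrow> degree Q = d) \<and> (\<forall>K. f K = poly Q (of_nat K))"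
proof -
  obtain c where c: "c d = L" "\<And>K. f K = (\<Sum>l\<le>d. c l * of_nat (K choose l))"
    using const_diff_newton[OF assms] by blast
  obtain B :: "nat \<Rightarrow> rat poly" where B: "\<And>l. degree (B l) = l" "\<And>l. coeff (B l) l > 0"
      "\<And>l x. poly (B l) x = x gchoose l"
    using gbinomial_poly by metis
  define Q where "Q = (\<Sum>l\<le>d. smult (c l) (B l))"
  have deg: "degree Q \<le> d"
    unfolding Q_def by (intro degree_sum_le) (auto intro: order_trans[OF degree_smult_le] simp: B(1))
  have "coeff Q d = (\<Sum>l\<le>d. c l * coeff (B l) d)"
    by (simp add: Q_def coeff_sum)
  also have "\<dots> = (\<Sum>l\<in>{d}. c l * coeff (B l) d)"
    by (intro sum.mono_neutral_right) (auto simp: coeff_eq_0 B(1))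
  finally have "coeff Q d = L * coeff (B d) d" using c(1) by simp
  then have "degree Q = d" if "L > 0"
    using that B(2)[of d] deg by (metis le_antisym le_degree less_irrefl mult_pos_pos)
  moreover have "f K = poly Q (of_nat K)" for K
    by (simp add: c(2) Q_def poly_sum B(3) binomial_gbinomial)
  ultimately show ?thesis using deg by blast
qed

section \<open>Polynomiality of the weighted binomial sums\<close>

text \<open>
  In the difference of the sum for \<open>insert s X\<close>, only the sum over \<open>X\<close> and the term \<open>u = 1\<close> reach the
  top order, so the leading constants satisfy \<open>L (insert s X) j = L X j + p s * L (insert s X) (j - 1)\<close>.
  This is the recursion of the complete homogeneous symmetric polynomials in the weights, which
  explains the sign conditions.
\<close>

lemma const_diff_weighted_binomial_sum:
  assumes "finite X" "X \<noteq> {}"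
  shows "\<exists>L\<ge>0. const_diff (card X + j - 1) L (weighted_binomial_sum p X c j) \<and>
    (j = 0 \<or> (\<exists>s\<in>X. p s > 0) \<longrightarrow> L > 0)"
  using assms
proof (induction X arbitrary: j rule: finite_induct)
  case empty
  then show ?case by simp
next
  case (insert s X)
  note fin = insert.hyps
  show ?case
  proof (induction j rule: less_induct)
    case (less j)
    let ?E = "\<lambda>j. weighted_binomial_sum p (insert s X) c j"
    show ?case
    \<comment> \<open>The first difference lowers the order \<open>card (insert s X) + j - 1\<close> by one, which is possible unless this order is \<open>0\<close>.\<close>
    proof (cases "X = {} \<and> j = 0")
      case True
      then have "const_diff 0 1 (?E 0)"
        by (simp add: const_diff_0 weighted_binomial_sum_0)
      then show ?thesis using True by (intro exI[of _ 1]) auto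
    next
      case False
      define d where "d = card X + j - 1"
      have d: "card (insert s X) + j - 1 = Suc d"
        using False fin by (auto simp: d_def card_gt_0_iff)
      obtain L where L: "L \<ge> 0" "const_diff d L (\<lambda>K. weighted_binomial_sum p X c j (Suc K))"
        "X \<noteq> {} \<and> (j = 0 \<or> (\<exists>s\<in>X. p s > 0)) \<longrightarrow> L > 0"
      proof (cases "X = {}")
        case True
        then have "(\<lambda>K. weighted_binomial_sum p X c j (Suc K)) = (\<lambda>_. 0)"
          by (simp add: weighted_binomial_sum_def compositions_empty)
        then show ?thesis using that[of 0] True by (simp add: const_diff_zero)
      next
        case F: False
        from insert.IH[OF F, of j] show ?thesis
          using that unfolding d_def by (metis const_diff_shift)
      qed
      have "\<forall>i<j. \<exists>L\<ge>0. const_diff (card X + i) L (?E i) \<and>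
          (i = 0 \<or> (\<exists>s'\<in>insert s X. p s' > 0) \<longrightarrow> L > 0)"
        using less.IH fin by simp
      then obtain M where M: "\<And>i. i < j \<Longrightarrow> M i \<ge> 0"
        "\<And>i. i < j \<Longrightarrow> const_diff (card X + i) (M i) (?E i)"
        "\<And>i. i < j \<Longrightarrow> i = 0 \<or> (\<exists>s'\<in>insert s X. p s' > 0) \<Longrightarrow> M i > 0"
        by metis
      define N where "N u = (if u = 1 then of_nat (p s) * M (j - 1) else 0)" for u :: nat
      have N: "const_diff d (N u) (\<lambda>K. (of_nat (p s) gchoose u) * ?E (j - u) K)" if "u \<in> {1..j}" for u
      proof (cases "u = 1")
        case True
        then show ?thesis using that M(2)[of "j - 1"] const_diff_mult
          by (auto simp: N_def d_def)
      next
        case u: False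
        have "const_diff d 0 (?E (j - u))"
          using const_diff_raise[OF M(2)[of "j - u"], of d] that u by (auto simp: d_def)
        from const_diff_mult[OF this, of "of_nat (p s) gchoose u"] show ?thesis
          using u by (simp add: N_def)
      qed
      have set: "{..j} = insert 0 {1..j}" by auto
      have "diff_op (?E j) = (\<lambda>K. weighted_binomial_sum p X c j (Suc K) +
          (\<Sum>u\<in>{1..j}. (of_nat (p s) gchoose u) * ?E (j - u) K))"
        unfolding diff_op_def weighted_binomial_sum_Suc[OF fin(1,2)] set by simp
      then have cd: "const_diff d (L + (\<Sum>u\<in>{1..j}. N u)) (diff_op (?E j))"
        using const_diff_add[OF L(2) const_diff_sum[of "{1..j}" d N, OF N]] by simp
      have sumN: "(\<Sum>u\<in>{1..j}. N u) = (if j = 0 then 0 else of_nat (p s) * M (j - 1))"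
      proof (cases "j = 0")
        case False
        have "(\<Sum>u\<in>{1..j}. N u) = (\<Sum>u\<in>{1}. N u)"
          using False by (intro sum.mono_neutral_right) (auto simp: N_def)
        then show ?thesis using False by (simp add: N_def)
      qed simp
      have nn: "(\<Sum>u\<in>{1..j}. N u) \<ge> 0" using sumN M(1)[of "j - 1"] by auto
      have pos: "L + (\<Sum>u\<in>{1..j}. N u) > 0" if *: "j = 0 \<or> (\<exists>s'\<in>insert s X. p s' > 0)"
      proof (cases "X \<noteq> {} \<and> (j = 0 \<or> (\<exists>s\<in>X. p s > 0))")
        case True
        then show ?thesis using L nn by auto
      next
        case F: False
        then have "j > 0" "p s > 0" using False * by auto
        then have "(\<Sum>u\<in>{1..j}. N u) > 0" using sumN M(3)[of "j - 1"] by auto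
        then show ?thesis using L(1) by simp
      qed
      show ?thesis
        using cd nn pos L(1) unfolding d const_diff_Suc
        by (intro exI[of _ "L + (\<Sum>u\<in>{1..j}. N u)"]) auto
    qed
  qed
qed

lemma weighted_binomial_sum_polynomial:
  fixes p :: "'m::finite \<Rightarrow> nat" and b :: int
  shows "\<exists>Q :: rat poly. (\<forall>k\<ge>b. weighted_binomial_sum p UNIV c j (nat (k - b)) = poly Q (of_int k)) \<and>
    degree Q \<le> CARD('m) + j - 1 \<and> (j = 0 \<or> (\<exists>s. p s > 0) \<longrightarrow> degree Q = CARD('m) + j - 1)"
proof -
  obtain L where L: "const_diff (CARD('m) + j - 1) L (weighted_binomial_sum p UNIV c j)"
    "j = 0 \<or> (\<exists>s. p s > 0) \<longrightarrow> L > 0"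
    using const_diff_weighted_binomial_sum[of "UNIV :: 'm set" j p c] by auto
  obtain Q where Q: "degree Q \<le> CARD('m) + j - 1" "L > 0 \<longrightarrow> degree Q = CARD('m) + j - 1"
    "\<And>K. weighted_binomial_sum p UNIV c j K = poly Q (of_nat K)"
    using const_diff_imp_poly[OF L(1)] by blast
  let ?R = "pcompose Q [:- of_int b, 1:]"
  have deg: "degree ?R = degree Q" by (simp add: degree_pcompose)
  have "weighted_binomial_sum p UNIV c j (nat (k - b)) = poly ?R (of_int k)" if "k \<ge> b" for k
  proof -
    have "(of_nat (nat (k - b)) :: rat) = of_int (k - b)" using that by (simp only: of_nat_nat diff_ge_0_iff_ge)
    then show ?thesis by (simp add: Q(3) poly_pcompose)
  qed
  then show ?thesis using Q(1,2) L(2) deg by (intro exI[of _ ?R]) auto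
qed

section \<open>Comparison with the largest weight\<close>

text \<open>
  For \<open>c \<ge> 0\<close> this is Pascal's rule and monotonicity. For \<open>c < 0\<close> the absolute value of \<open>c\<close> choose \<open>j\<close> is
  \<open>j - c - 1\<close> choose \<open>j\<close>, which explains the third assumption.
\<close>

lemma gbinomial_of_int_strict_less:
  fixes c t :: int
  assumes "1 \<le> j" "c < t" "int j - c \<le> t" "int j \<le> t"
  shows "(of_int c :: rat) gchoose j < of_int t gchoose j"
proof -
  obtain i where i: "j = Suc i" using assms(1) by (cases j) auto
  define N where "N = nat (t - 1)"
  have N: "t = 1 + int N" using assms by (simp add: N_def)
  have top: "(of_int t :: rat) gchoose j = of_nat (N choose i) + of_nat (N choose j)"
    using gbinomial_Suc_Suc[of "of_nat N :: rat" i] by (simp add: N i add.commute binomial_gbinomial)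
  have pos: "(0::rat) < of_nat (N choose i)" using assms N i by simp
  have "(of_int c :: rat) gchoose j \<le> of_nat (N choose j)"
  proof (cases "c \<ge> 0")
    case True
    then have "(of_int c :: rat) gchoose j = of_nat (nat c choose j)"
      by (simp add: of_int_gbinomial[symmetric] gbinomial_nneg)
    also have "\<dots> \<le> of_nat (N choose j)"
      using assms N True by (intro of_nat_mono binomial_right_mono) linarith
    finally show ?thesis .
  next
    case False
    then have "(of_int c :: rat) gchoose j = (- 1) ^ j * of_nat ((j + nat (- c) - 1) choose j)"
      by (simp add: of_int_gbinomial[symmetric] gbinomial_neg)
    also have "\<dots> \<le> of_nat ((j + nat (- c) - 1) choose j)"
      by (simp add: minus_one_power_iff)
    also have "\<dots> \<le> of_nat (N choose j)"
      using assms N False by (intro of_nat_mono binomial_right_mono) linarith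
    finally show ?thesis .
  qed
  then show ?thesis using top pos by linarith
qed

lemma sum_weights_le:
  fixes p :: "'m::finite \<Rightarrow> nat"
  assumes "\<And>s. p s \<le> M" "\<beta> \<in> compositions UNIV K"
  shows "(\<Sum>s\<in>UNIV. p s * \<beta> s) \<le> M * K"
proof -
  have "(\<Sum>s\<in>UNIV. p s * \<beta> s) \<le> (\<Sum>s\<in>UNIV. M * \<beta> s)"
    using assms(1) by (intro sum_mono mult_right_mono) auto
  also have "\<dots> = M * K" using assms(2) by (simp add: compositions_def flip: sum_distrib_left)
  finally show ?thesis .
qed

text \<open>
  The lower bound on \<open>K\<close> makes the top value \<open>M * K + a\<close> at least \<open>j\<close> and at least \<open>j - a\<close>; the
  latter controls the negative arguments, none of which is below \<open>a\<close>.
\<close>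

lemma gbinomial_weight_strict_less:
  fixes a :: int
  assumes "1 \<le> j" "w < M * K" "int j + 2 * \<bar>a\<bar> \<le> int K"
  shows "(of_int a + of_nat w :: rat) gchoose j < of_int (int M * int K + a) gchoose j"
proof -
  have "M \<ge> 1" using assms(2) by (cases M) auto
  then have le: "int K \<le> int (M * K)" by (intro of_nat_mono) simp
  have "(of_int (a + int w) :: rat) gchoose j < of_int (int (M * K) + a) gchoose j"
  proof (intro gbinomial_of_int_strict_less)
    have "int w < int (M * K)" using assms(2) by (simp only: of_nat_less_iff)
    then show "a + int w < int (M * K) + a" by linarith
  qed (use assms(1,3) le in linarith)+
  then show ?thesis by simp
qed

lemma gbinomial_weight_le:
  fixes a :: int
  assumes "w \<le> M * K" "int j + 2 * \<bar>a\<bar> \<le> int K"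
  shows "(of_int a + of_nat w :: rat) gchoose j \<le> of_int (int M * int K + a) gchoose j"
proof (cases "w = M * K \<or> j = 0")
  case True
  then show ?thesis by (auto simp: add.commute)
next
  case False
  then show ?thesis using gbinomial_weight_strict_less[of j w M K a] assms by simp
qed

lemma weighted_binomial_sum_const:
  fixes p :: "'m::finite \<Rightarrow> nat"
  assumes "\<And>s. p s = M"
  shows "weighted_binomial_sum p UNIV (of_int a) j K =
    of_nat (card (compositions (UNIV :: 'm set) K)) * (of_int (int M * int K + a) gchoose j)"
proof -
  have "(\<Sum>s\<in>UNIV. p s * \<beta> s) = M * K" if "\<beta> \<in> compositions UNIV K" for \<beta>
    using that assms by (simp add: compositions_def flip: sum_distrib_left)
  then show ?thesis
    unfolding weighted_binomial_sum_def by (simp add: add.commute del: of_nat_sum)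
qed

lemma weighted_binomial_sum_le:
  fixes p :: "'m::finite \<Rightarrow> nat"
  assumes "\<And>s. p s \<le> M" "int j + 2 * \<bar>a\<bar> \<le> int K"
  shows "weighted_binomial_sum p UNIV (of_int a) j K \<le>
    of_nat (card (compositions (UNIV :: 'm set) K)) * (of_int (int M * int K + a) gchoose j)"
  unfolding weighted_binomial_sum_def
  by (intro sum_bounded_above gbinomial_weight_le sum_weights_le assms)

text \<open>
  A smaller weight at \<open>s\<close> is detected by the composition that is concentrated at \<open>s\<close>.
\<close>

lemma weighted_binomial_sum_less:
  fixes p :: "'m::finite \<Rightarrow> nat"
  assumes "\<And>s. p s \<le> M" "int j + 2 * \<bar>a\<bar> \<le> int K" "1 \<le> j" "p s < M"
  shows "weighted_binomial_sum p UNIV (of_int a) j K <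
    of_nat (card (compositions (UNIV :: 'm set) K)) * (of_int (int M * int K + a) gchoose j)"
proof -
  let ?C = "compositions (UNIV :: 'm set) K"
  define \<beta>0 where "\<beta>0 = (\<lambda>_. 0)(s := K)"
  have supp: "(\<Sum>t\<in>UNIV. g t * \<beta>0 t) = g s * K" for g :: "'m \<Rightarrow> nat"
  proof -
    have "(\<Sum>t\<in>UNIV. g t * \<beta>0 t) = (\<Sum>t\<in>{s}. g t * \<beta>0 t)"
      by (intro sum.mono_neutral_right) (auto simp: \<beta>0_def)
    then show ?thesis by (simp add: \<beta>0_def)
  qed
  have \<beta>0: "\<beta>0 \<in> ?C" using supp[of "\<lambda>_. 1"] by (simp add: compositions_def)
  have "K > 0" using assms(2,3) by auto
  then have lt: "(\<Sum>t\<in>UNIV. p t * \<beta>0 t) < M * K" using supp[of p] assms(4) by simp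
  have "weighted_binomial_sum p UNIV (of_int a) j K < (\<Sum>\<beta>\<in>?C. of_int (int M * int K + a) gchoose j)"
    unfolding weighted_binomial_sum_def
  proof (rule sum_strict_mono_ex1)
    show "finite ?C" by (simp add: finite_compositions)
    show "\<forall>\<beta>\<in>?C. (of_int a + of_nat (\<Sum>s\<in>UNIV. p s * \<beta> s) :: rat) gchoose j \<le> of_int (int M * int K + a) gchoose j"
      using gbinomial_weight_le[OF sum_weights_le[where p = p, OF assms(1)] assms(2)] by blast
    show "\<exists>\<beta>\<in>?C. (of_int a + of_nat (\<Sum>s\<in>UNIV. p s * \<beta> s) :: rat) gchoose j < of_int (int M * int K + a) gchoose j"
      using gbinomial_weight_strict_less[OF assms(3) lt assms(2)] \<beta>0 by blast
  qed
  then show ?thesis by simp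
qed

section \<open>Monomial bases of polynomial rings\<close>

lemma const_pol_add: "const_pol (c + d) = const_pol c + const_pol d"
  by (simp add: const_pol_def single_add)

lemma const_pol_mult: "const_pol (c * d) = (const_pol c * const_pol d :: ('v, 'k::comm_ring_1) mpol)"
  by (simp add: const_pol_def mult_single)

lemma const_pol_1 [simp]: "const_pol 1 = (1 :: ('v, 'k::comm_ring_1) mpol)"
  by (simp add: const_pol_def)

lemma const_pol_uminus: "const_pol (- c) = - const_pol c"
  by (simp add: const_pol_def single_uminus)

lemma lookup_const_pol_mult:
  "Poly_Mapping.lookup (const_pol c * f) t = c * Poly_Mapping.lookup f t"
  for f :: "('v, 'k::comm_ring_1) mpol"
  by (simp add: const_pol_def mult_map_scale_conv_mult[symmetric] Poly_Mapping.map.rep_eq when_def)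

interpretation mpol: vector_space "\<lambda>(c::'k::field) (f::('v, 'k) mpol). const_pol c * f"
  by unfold_locales (auto simp: algebra_simps const_pol_add const_pol_mult)

lemma mpol_expansion:
  "f = (\<Sum>t\<in>Poly_Mapping.keys f. const_pol (Poly_Mapping.lookup f t) * Poly_Mapping.single t 1)"
  for f :: "('v, 'k::comm_ring_1) mpol"
proof (rule poly_mapping_eqI)
  fix t
  have "Poly_Mapping.lookup (\<Sum>u\<in>Poly_Mapping.keys f. const_pol (Poly_Mapping.lookup f u) * Poly_Mapping.single u 1) t
      = (\<Sum>u\<in>Poly_Mapping.keys f. Poly_Mapping.lookup f u * (if u = t then 1 else 0))"
    by (simp add: lookup_sum lookup_const_pol_mult lookup_single when_def)
  also have "\<dots> = (\<Sum>u\<in>Poly_Mapping.keys f. if u = t then Poly_Mapping.lookup f u else 0)"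
    by (intro sum.cong) auto
  also have "\<dots> = Poly_Mapping.lookup f t"
    by (simp add: in_keys_iff)
  finally show "Poly_Mapping.lookup f t = Poly_Mapping.lookup (\<Sum>u\<in>Poly_Mapping.keys f. const_pol (Poly_Mapping.lookup f u) * Poly_Mapping.single u 1) t"
    by simp
qed

lemma mpol_in_span_monomials:
  fixes f :: "('v, 'k::field) mpol"
  assumes "Poly_Mapping.keys f \<subseteq> T"
  shows "f \<in> mpol.span ((\<lambda>t. Poly_Mapping.single t 1) ` T)"
proof -
  have "(\<Sum>t\<in>Poly_Mapping.keys f. const_pol (Poly_Mapping.lookup f t) * Poly_Mapping.single t 1)
      \<in> mpol.span ((\<lambda>t. Poly_Mapping.single t 1) ` T)"
    using assms by (intro mpol.span_sum mpol.span_scale mpol.span_base) auto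
  then show ?thesis unfolding mpol_expansion[symmetric] .
qed

lemma inj_monomial: "inj_on (\<lambda>t. Poly_Mapping.single t (1::'k::field) :: ('v, 'k) mpol) T"
proof (rule inj_onI)
  fix t u :: "'v \<Rightarrow>\<^sub>0 nat"
  assume eq: "Poly_Mapping.single t (1::'k) = (Poly_Mapping.single u 1 :: ('v, 'k) mpol)"
  have "Poly_Mapping.keys (Poly_Mapping.single t (1::'k)) = Poly_Mapping.keys (Poly_Mapping.single u (1::'k))"
    unfolding eq ..
  then show "t = u" by simp
qed

lemma dim_mpol_supported:
  assumes "finite T"
  shows "mpol.dim {f :: ('v, 'k::field) mpol. Poly_Mapping.keys f \<subseteq> T} = card T"
proof (rule mpol.dim_unique)
  let ?B = "(\<lambda>t. Poly_Mapping.single t 1 :: ('v, 'k) mpol) ` T"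
  show "?B \<subseteq> {f. Poly_Mapping.keys f \<subseteq> T}" by auto
  show "{f. Poly_Mapping.keys f \<subseteq> T} \<subseteq> mpol.span ?B"
    using mpol_in_span_monomials by blast
  show "mpol.independent ?B"
  proof (rule mpol.independent_if_scalars_zero)
    show "finite ?B" using assms by simp
    fix u x assume eq: "(\<Sum>x\<in>?B. const_pol (u x) * x) = 0" and x: "x \<in> ?B"
    then obtain t where t: "t \<in> T" "x = Poly_Mapping.single t 1" by blast
    have "0 = Poly_Mapping.lookup (\<Sum>x\<in>?B. const_pol (u x) * x) t"
      by (simp add: eq)
    also have "\<dots> = (\<Sum>s\<in>T. Poly_Mapping.lookup (const_pol (u (Poly_Mapping.single s 1)) * Poly_Mapping.single s 1 :: ('v,'k) mpol) t)"
      by (simp add: sum.reindex inj_monomial lookup_sum)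
    also have "\<dots> = (\<Sum>s\<in>T. if s = t then u (Poly_Mapping.single s 1) else 0)"
      by (intro sum.cong) (auto simp: lookup_const_pol_mult lookup_single when_def)
    also have "\<dots> = u x" using t assms by simp
    finally show "u x = 0" by simp
  qed
  show "card ?B = card T" by (simp add: card_image inj_monomial)
qed

section \<open>The Krull dimension of a polynomial ring\<close>

lemma module_mult: "module ((*) :: 'r::comm_ring_1 \<Rightarrow> 'r \<Rightarrow> 'r)"
  by unfold_locales (auto simp: algebra_simps)

lemma prime_idealD:
  assumes "prime_ideal P"
  shows "0 \<in> P" "x \<in> P \<Longrightarrow> y \<in> P \<Longrightarrow> x + y \<in> P" "x \<in> P \<Longrightarrow> c * x \<in> P"
    "x * y \<in> P \<Longrightarrow> x \<in> P \<or> y \<in> P" "1 \<notin> P"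
proof -
  have sub: "module.subspace (*) P" using assms by (simp add: prime_ideal_def)
  show 0: "0 \<in> P" and add: "x \<in> P \<Longrightarrow> y \<in> P \<Longrightarrow> x + y \<in> P" and mult: "x \<in> P \<Longrightarrow> c * x \<in> P"
    for x y c using sub unfolding module.subspace_def[OF module_mult] by auto
  show "x * y \<in> P \<Longrightarrow> x \<in> P \<or> y \<in> P" using assms by (auto simp: prime_ideal_def)
  show "1 \<notin> P"
  proof
    assume "1 \<in> P"
    then have "c \<in> P" for c using mult[of 1 c] by simp
    then show False using assms by (auto simp: prime_ideal_def)
  qed
qed

lemma prime_ideal_diff:
  assumes "prime_ideal P" "x + y \<in> P" "y \<in> P"
  shows "x \<in> P"
proof -
  have "(x + y) + (- 1) * y \<in> P"
    using prime_idealD(2,3)[OF assms(1)] assms(2,3) by blast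
  then show ?thesis by simp
qed

lemma prime_ideal_power:
  assumes "prime_ideal P" "x ^ k \<in> P"
  shows "x \<in> P"
  using assms(2)
proof (induction k)
  case 0
  then show ?case using prime_idealD(5)[OF assms(1)] by simp
next
  case (Suc k)
  then show ?case using prime_idealD(4)[OF assms(1), of x "x ^ k"] by auto
qed

lemma prime_ideal_const_pol:
  fixes P :: "('v, 'k::field) mpol set"
  assumes "prime_ideal P" "c \<noteq> 0"
  shows "const_pol c \<notin> P"
proof
  assume "const_pol c \<in> P"
  then have "const_pol (inverse c) * const_pol c \<in> P" using prime_idealD(3)[OF assms(1)] by blast
  then show False using prime_idealD(5)[OF assms(1)] assms(2)
    by (simp add: const_pol_mult[symmetric])
qed

text \<open>
  The monomials in \<open>x r, \<dots>, x (l - 1)\<close> are linearly independent even modulo \<open>P r\<close>. In a combination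
  that lies in \<open>P r\<close>, the least power of \<open>x r\<close> that occurs can be cancelled, since \<open>x r\<close> lies outside the
  prime \<open>P r\<close>. The quotient lies in \<open>P (Suc r)\<close>, and so do its terms still divisible by \<open>x r\<close>; the other
  terms form a nontrivial combination of monomials in the later elements, to which induction applies. At
  the end of the chain a nonzero constant would lie in a proper ideal.
\<close>

lemma prime_chain_separating_independent:
  fixes P :: "nat \<Rightarrow> ('v, 'k::field) mpol set" and x :: "nat \<Rightarrow> ('v, 'k) mpol"
  assumes P: "\<And>i. i \<le> l \<Longrightarrow> prime_ideal (P i)" "\<And>i. i < l \<Longrightarrow> P i \<subseteq> P (Suc i)"
    and x: "\<And>i. i < l \<Longrightarrow> x i \<in> P (Suc i)" "\<And>i. i < l \<Longrightarrow> x i \<notin> P i"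
    and "r \<le> l" "finite I" "I \<noteq> {}" "\<And>\<alpha>. \<alpha> \<in> I \<Longrightarrow> c \<alpha> \<noteq> 0"
    and "\<And>\<alpha> \<beta>. \<alpha> \<in> I \<Longrightarrow> \<beta> \<in> I \<Longrightarrow> (\<forall>i\<in>{r..<l}. \<alpha> i = \<beta> i) \<Longrightarrow> \<alpha> = \<beta>"
  shows "(\<Sum>\<alpha>\<in>I. const_pol (c \<alpha>) * (\<Prod>i=r..<l. x i ^ \<alpha> i)) \<notin> P r"
  using assms(5-)
proof (induction r arbitrary: I rule: inc_induct)
  case base
  then obtain \<alpha> where \<alpha>: "\<alpha> \<in> I" by blast
  then have "I = {\<alpha>}" using base(4) by auto
  then show ?case using prime_ideal_const_pol[OF P(1)[OF order.refl]] base \<alpha> by simp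
next
  case (step r)
  define \<mu> where "\<mu> = Min ((\<lambda>\<alpha>. \<alpha> r) ` I)"
  have \<mu>_le: "\<mu> \<le> \<alpha> r" if "\<alpha> \<in> I" for \<alpha> using that step.prems by (auto simp: \<mu>_def)
  have "\<mu> \<in> (\<lambda>\<alpha>. \<alpha> r) ` I" using step.prems by (auto simp: \<mu>_def intro!: Min_in)
  then obtain \<alpha>0 where \<alpha>0: "\<alpha>0 \<in> I" "\<alpha>0 r = \<mu>" by auto
  define I0 where "I0 = {\<alpha> \<in> I. \<alpha> r = \<mu>}"
  define X where "X \<alpha> = const_pol (c \<alpha>) * (\<Prod>i=Suc r..<l. x i ^ \<alpha> i)" for \<alpha>
  have I0: "finite I0" "I0 \<noteq> {}" "I0 \<subseteq> I" using step.prems \<alpha>0 by (auto simp: I0_def)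
  have ih: "(\<Sum>\<alpha>\<in>I0. X \<alpha>) \<notin> P (Suc r)"
    unfolding X_def
  proof (rule step.IH[OF I0(1,2)])
    show "c \<alpha> \<noteq> 0" if "\<alpha> \<in> I0" for \<alpha> using that step.prems by (auto simp: I0_def)
    show "\<alpha> = \<beta>" if "\<alpha> \<in> I0" "\<beta> \<in> I0" "\<forall>i\<in>{Suc r..<l}. \<alpha> i = \<beta> i" for \<alpha> \<beta>
    proof (rule step.prems(4))
      show "\<alpha> \<in> I" "\<beta> \<in> I" using that I0 by auto
      show "\<forall>i\<in>{r..<l}. \<alpha> i = \<beta> i"
        using that by (auto simp: I0_def le_eq_less_or_eq Suc_le_eq)
    qed
  qed
  let ?R = "\<Sum>\<alpha>\<in>I - I0. X \<alpha> * x r ^ (\<alpha> r - Suc \<mu>)"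
  have split: "const_pol (c \<alpha>) * (\<Prod>i=r..<l. x i ^ \<alpha> i) = x r ^ \<alpha> r * X \<alpha>" for \<alpha>
    using step.hyps by (simp add: X_def prod.atLeast_Suc_lessThan algebra_simps)
  have "(\<Sum>\<alpha>\<in>I. const_pol (c \<alpha>) * (\<Prod>i=r..<l. x i ^ \<alpha> i)) =
      (\<Sum>\<alpha>\<in>I0. x r ^ \<alpha> r * X \<alpha>) + (\<Sum>\<alpha>\<in>I - I0. x r ^ \<alpha> r * X \<alpha>)"
    unfolding split using sum.subset_diff[OF I0(3) step.prems(1)] by (simp add: add.commute)
  also have "(\<Sum>\<alpha>\<in>I0. x r ^ \<alpha> r * X \<alpha>) = x r ^ \<mu> * (\<Sum>\<alpha>\<in>I0. X \<alpha>)"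
    by (simp add: I0_def sum_distrib_left)
  also have "(\<Sum>\<alpha>\<in>I - I0. x r ^ \<alpha> r * X \<alpha>) = x r ^ \<mu> * (x r * ?R)"
    unfolding sum_distrib_left
  proof (rule sum.cong)
    fix \<alpha> assume "\<alpha> \<in> I - I0"
    then have "\<alpha> r = \<mu> + Suc (\<alpha> r - Suc \<mu>)" using \<mu>_le[of \<alpha>] by (auto simp: I0_def)
    then have "x r ^ \<alpha> r = x r ^ \<mu> * x r ^ Suc (\<alpha> r - Suc \<mu>)" by (metis power_add)
    then show "x r ^ \<alpha> r * X \<alpha> = x r ^ \<mu> * (x r * (X \<alpha> * x r ^ (\<alpha> r - Suc \<mu>)))"
      by (simp add: algebra_simps)
  qed simp
  finally have eq: "(\<Sum>\<alpha>\<in>I. const_pol (c \<alpha>) * (\<Prod>i=r..<l. x i ^ \<alpha> i)) =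
      x r ^ \<mu> * ((\<Sum>\<alpha>\<in>I0. X \<alpha>) + x r * ?R)" by (simp add: distrib_left)
  have Pr: "prime_ideal (P r)" "prime_ideal (P (Suc r))" using P(1) step.hyps by auto
  show ?case
  proof
    assume "(\<Sum>\<alpha>\<in>I. const_pol (c \<alpha>) * (\<Prod>i=r..<l. x i ^ \<alpha> i)) \<in> P r"
    then have "(\<Sum>\<alpha>\<in>I0. X \<alpha>) + x r * ?R \<in> P r"
      unfolding eq using prime_idealD(4)[OF Pr(1)] prime_ideal_power[OF Pr(1)] x(2) step.hyps by blast
    then have "(\<Sum>\<alpha>\<in>I0. X \<alpha>) + x r * ?R \<in> P (Suc r)" using P(2) step.hyps by blast
    moreover have "x r * ?R \<in> P (Suc r)"
      using prime_idealD(3)[OF Pr(2) x(1)[OF step.hyps(2)], of ?R] by (simp add: mult.commute)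
    ultimately show False using ih prime_ideal_diff[OF Pr(2)] by blast
  qed
qed

definition exponents_le :: "nat \<Rightarrow> ('v, 'k::zero) mpol set" where
  "exponents_le D = {f. \<forall>t\<in>Poly_Mapping.keys f. \<forall>v. Poly_Mapping.lookup t v \<le> D}"

lemma exponents_le_mult:
  fixes f g :: "('v, 'k::comm_ring_1) mpol"
  assumes "f \<in> exponents_le D" "g \<in> exponents_le E"
  shows "f * g \<in> exponents_le (D + E)"
  using assms keys_mult[of f g] unfolding exponents_le_def by (fastforce simp: lookup_add intro: add_mono)

lemma exponents_le_power:
  fixes f :: "('v, 'k::comm_ring_1) mpol"
  assumes "f \<in> exponents_le D"
  shows "f ^ k \<in> exponents_le (k * D)"
  by (induction k) (use exponents_le_mult[OF assms] in \<open>auto simp: exponents_le_def\<close>)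

lemma exponents_le_prod:
  fixes f :: "'i \<Rightarrow> ('v, 'k::comm_ring_1) mpol"
  assumes "\<And>i. i \<in> I \<Longrightarrow> f i \<in> exponents_le D"
  shows "(\<Prod>i\<in>I. f i) \<in> exponents_le (card I * D)"
proof -
  have one: "1 \<in> (exponents_le 0 :: ('v, 'k) mpol set)" by (simp add: exponents_le_def)
  show ?thesis using assms
    by (induction I rule: infinite_finite_induct) (auto intro: exponents_le_mult one)
qed

lemma exponents_le_mono: "D \<le> E \<Longrightarrow> exponents_le D \<subseteq> exponents_le E"
  by (auto simp: exponents_le_def intro: order_trans)

lemma exponents_le_exists:
  fixes f :: "('v::finite, 'k::zero) mpol"
  shows "\<exists>D. f \<in> exponents_le D"
proof -
  let ?S = "\<Union>t\<in>Poly_Mapping.keys f. range (Poly_Mapping.lookup t)"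
  have "finite ?S" by auto
  then have "\<forall>t\<in>Poly_Mapping.keys f. \<forall>v. Poly_Mapping.lookup t v \<le> Max ?S"
    by (auto intro!: Max_ge)
  then show ?thesis unfolding exponents_le_def by blast
qed

lemma card_bounded_exponents:
  "finite {t :: 'v::finite \<Rightarrow>\<^sub>0 nat. \<forall>v. Poly_Mapping.lookup t v \<le> D}"
  "card {t :: 'v::finite \<Rightarrow>\<^sub>0 nat. \<forall>v. Poly_Mapping.lookup t v \<le> D} \<le> (D + 1) ^ CARD('v)"
proof -
  let ?F = "{t :: 'v::finite \<Rightarrow>\<^sub>0 nat. \<forall>v. Poly_Mapping.lookup t v \<le> D}"
  have sub: "Poly_Mapping.lookup ` ?F \<subseteq> (UNIV \<rightarrow>\<^sub>E {..D})" by (auto simp: PiE_def Pi_def)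
  have inj: "inj_on Poly_Mapping.lookup ?F" by (auto intro: inj_onI poly_mapping_eqI)
  have fin: "finite ((UNIV :: 'v set) \<rightarrow>\<^sub>E {..D})" by (simp add: finite_PiE)
  show "finite ?F" using finite_imageD[OF finite_subset[OF sub fin] inj] .
  have "card ?F = card (Poly_Mapping.lookup ` ?F)" using inj by (simp add: card_image)
  also have "\<dots> \<le> card ((UNIV :: 'v set) \<rightarrow>\<^sub>E {..D})" by (rule card_mono[OF fin sub])
  also have "\<dots> = (D + 1) ^ CARD('v)" by (simp add: card_PiE)
  finally show "card ?F \<le> (D + 1) ^ CARD('v)" .
qed

text \<open>
  There are \<open>(N + 1) ^ l\<close> monomials in the separating elements with all exponents at most \<open>N\<close>. They
  are independent, but lie in a space of polynomials whose dimension grows like \<open>N\<close> to the number of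
  variables.
\<close>

lemma prime_chain_length_le:
  fixes P :: "nat \<Rightarrow> ('v::finite, 'k::field) mpol set"
  assumes P: "\<And>i. i \<le> l \<Longrightarrow> prime_ideal (P i)" "\<And>i. i < l \<Longrightarrow> P i \<subset> P (Suc i)"
  shows "l \<le> CARD('v)"
proof -
  have "\<forall>i<l. \<exists>y. y \<in> P (Suc i) \<and> y \<notin> P i" using P(2) by blast
  then obtain x where x: "\<And>i. i < l \<Longrightarrow> x i \<in> P (Suc i)" "\<And>i. i < l \<Longrightarrow> x i \<notin> P i" by metis
  have "\<forall>i. \<exists>D. x i \<in> exponents_le D" using exponents_le_exists by blast
  then obtain d where d: "\<And>i. x i \<in> exponents_le (d i)" by metis
  define D where "D = (\<Sum>i<l. d i)"
  have D: "x i \<in> exponents_le D" if "i < l" for i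
    using d[of i] exponents_le_mono[of "d i" D] that by (auto simp: D_def intro!: member_le_sum)
  define m where "m \<alpha> = (\<Prod>i=0..<l. x i ^ \<alpha> i)" for \<alpha> :: "nat \<Rightarrow> nat"
  have key: "(\<Sum>\<alpha>\<in>I. const_pol (c \<alpha>) * m \<alpha>) \<noteq> 0"
    if "finite I" "I \<noteq> {}" "\<And>\<alpha>. \<alpha> \<in> I \<Longrightarrow> c \<alpha> \<noteq> 0" "I \<subseteq> {0..<l} \<rightarrow>\<^sub>E UNIV" for c I
  proof -
    have "(\<Sum>\<alpha>\<in>I. const_pol (c \<alpha>) * m \<alpha>) \<notin> P 0"
      unfolding m_def
    proof (rule prime_chain_separating_independent[where P = P and x = x and r = 0 and l = l])
      show "\<alpha> = \<beta>" if "\<alpha> \<in> I" "\<beta> \<in> I" "\<forall>i\<in>{0..<l}. \<alpha> i = \<beta> i" for \<alpha> \<beta>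
        using that \<open>I \<subseteq> {0..<l} \<rightarrow>\<^sub>E UNIV\<close> by (intro PiE_ext[where k = "{0..<l}" and s = "\<lambda>_. UNIV"]) auto
    qed (use P x that in auto)
    then show ?thesis using prime_idealD(1)[OF P(1)[of 0]] by auto
  qed
  have count: "(N + 1) ^ l \<le> (l * (N * D) + 1) ^ CARD('v)" for N
  proof -
    let ?I = "{0..<l} \<rightarrow>\<^sub>E {..N}"
    have finI: "finite ?I" by (simp add: finite_PiE)
    have sub: "?I \<subseteq> {0..<l} \<rightarrow>\<^sub>E UNIV" by (auto simp: PiE_def Pi_def)
    have inj: "inj_on m ?I"
    proof (rule inj_onI, rule ccontr)
      fix \<alpha> \<beta> assume ab: "\<alpha> \<in> ?I" "\<beta> \<in> ?I" "m \<alpha> = m \<beta>" "\<alpha> \<noteq> \<beta>"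
      define c :: "(nat \<Rightarrow> nat) \<Rightarrow> 'k" where "c \<gamma> = (if \<gamma> = \<alpha> then 1 else - 1)" for \<gamma>
      have "(\<Sum>\<gamma>\<in>{\<alpha>, \<beta>}. const_pol (c \<gamma>) * m \<gamma>) = 0"
        using ab by (simp add: c_def const_pol_uminus)
      moreover have "{\<alpha>, \<beta>} \<subseteq> {0..<l} \<rightarrow>\<^sub>E UNIV" using ab sub by blast
      moreover have "c \<gamma> \<noteq> 0" for \<gamma> by (simp add: c_def)
      ultimately show False using key[of "{\<alpha>, \<beta>}" c] by blast
    qed
    have indep: "mpol.independent (m ` ?I)"
    proof (rule mpol.independent_if_scalars_zero)
      show "finite (m ` ?I)" using finI by simp
      fix u y assume eq: "(\<Sum>y\<in>m ` ?I. const_pol (u y) * y) = 0" and y: "y \<in> m ` ?I"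
      let ?J = "{\<alpha>\<in>?I. u (m \<alpha>) \<noteq> 0}"
      have "(\<Sum>\<alpha>\<in>?J. const_pol (u (m \<alpha>)) * m \<alpha>) = (\<Sum>\<alpha>\<in>?I. const_pol (u (m \<alpha>)) * m \<alpha>)"
        using finI by (intro sum.mono_neutral_left) auto
      also have "\<dots> = 0" using eq by (simp add: sum.reindex[OF inj])
      finally have sum0: "(\<Sum>\<alpha>\<in>?J. const_pol (u (m \<alpha>)) * m \<alpha>) = 0" .
      have "finite ?J" "?J \<subseteq> {0..<l} \<rightarrow>\<^sub>E UNIV" using finI sub by (simp, blast)
      then have "?J = {}" using key[of ?J "\<lambda>\<alpha>. u (m \<alpha>)"] sum0 by blast
      then show "u y = 0" using y by blast
    qed
    let ?T = "{t :: 'v \<Rightarrow>\<^sub>0 nat. \<forall>v. Poly_Mapping.lookup t v \<le> l * (N * D)}"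
    have "m \<alpha> \<in> exponents_le (l * (N * D))" if "\<alpha> \<in> ?I" for \<alpha>
    proof -
      have "x i ^ \<alpha> i \<in> exponents_le (N * D)" if "i \<in> {0..<l}" for i
      proof -
        have "\<alpha> i \<le> N" using \<open>\<alpha> \<in> ?I\<close> that by auto
        then show ?thesis
          using exponents_le_power[OF D[of i], of "\<alpha> i"] that exponents_le_mono[of "\<alpha> i * D" "N * D"] by auto
      qed
      from exponents_le_prod[of "{0..<l}", OF this] show ?thesis by (simp add: m_def)
    qed
    then have "m ` ?I \<subseteq> mpol.span ((\<lambda>t. Poly_Mapping.single t 1) ` ?T)"
      by (auto intro!: mpol_in_span_monomials simp: exponents_le_def)
    then have "card (m ` ?I) \<le> card ((\<lambda>t. Poly_Mapping.single t 1 :: ('v, 'k) mpol) ` ?T)"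
      using mpol.independent_span_bound[OF _ indep] card_bounded_exponents(1) by blast
    also have "\<dots> \<le> card ?T" by (rule card_image_le[OF card_bounded_exponents(1)])
    also have "\<dots> \<le> (l * (N * D) + 1) ^ CARD('v)" by (rule card_bounded_exponents(2))
    finally show ?thesis by (simp add: card_image[OF inj] card_PiE)
  qed
  show ?thesis
  proof (rule ccontr)
    assume "\<not> l \<le> CARD('v)"
    then have l: "Suc CARD('v) \<le> l" by simp
    \<comment> \<open>For \<open>l\<close> larger than the number of variables the count implies \<open>N + 1 \<le> (l * D + 1) ^ CARD('v)\<close> for every \<open>N\<close>,
      which fails for this one.\<close>
    define N where "N = (l * D + 1) ^ CARD('v)"
    have "(N + 1) * (N + 1) ^ CARD('v) \<le> (N + 1) ^ l"
      using power_increasing[OF l, of "N + 1"] by simp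
    also have "\<dots> \<le> (l * (N * D) + 1) ^ CARD('v)" by (rule count)
    also have "\<dots> \<le> ((l * D + 1) * (N + 1)) ^ CARD('v)"
      by (intro power_mono) (auto simp: algebra_simps)
    also have "\<dots> = N * (N + 1) ^ CARD('v)" unfolding power_mult_distrib N_def ..
    finally show False by simp
  qed
qed

text \<open>
  The ideal generated by the variables in \<open>V\<close>, described by its monomials.
\<close>

definition variable_ideal :: "'v set \<Rightarrow> ('v, 'k::zero) mpol set" where
  "variable_ideal V = {f. \<forall>t\<in>Poly_Mapping.keys f. \<exists>v\<in>V. Poly_Mapping.lookup t v \<noteq> 0}"

text \<open>
  Modulo the ideal, every polynomial agrees with the part \<open>R f\<close> that avoids the variables in \<open>V\<close>, and a
  product of two such parts lies in the ideal only if it is \<open>0\<close>. So primality follows from the absence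
  of zero divisors.
\<close>

lemma prime_variable_ideal:
  "prime_ideal (variable_ideal V :: ('v::{finite,linorder}, 'k::field) mpol set)"
proof -
  let ?P = "variable_ideal V :: ('v, 'k) mpol set"
  have add: "f + g \<in> ?P" if "f \<in> ?P" "g \<in> ?P" for f g
    using that keys_add[of f g] unfolding variable_ideal_def by blast
  have mult: "f * g \<in> ?P" if "g \<in> ?P" for f g
  proof -
    have "\<exists>v\<in>V. Poly_Mapping.lookup t v \<noteq> 0" if t: "t \<in> Poly_Mapping.keys (f * g)" for t
    proof -
      obtain u w where "t = u + w" "w \<in> Poly_Mapping.keys g"
        using t keys_mult[of f g] by blast
      then show ?thesis using \<open>g \<in> ?P\<close> by (auto simp: variable_ideal_def lookup_add)
    qed
    then show ?thesis by (simp add: variable_ideal_def)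
  qed
  have sub: "module.subspace (*) ?P"
  proof -
    have "0 \<in> ?P" by (simp add: variable_ideal_def)
    then show ?thesis unfolding module.subspace_def[OF module_mult] by (intro conjI ballI allI add mult)
  qed
  have "1 \<notin> ?P" by (simp add: variable_ideal_def)
  then have neq: "?P \<noteq> UNIV" by blast
  define free where "free f = {t\<in>Poly_Mapping.keys f. \<forall>v\<in>V. Poly_Mapping.lookup t v = 0}" for f :: "('v, 'k) mpol"
  define R where "R f = (\<Sum>t\<in>free f. Poly_Mapping.single t (Poly_Mapping.lookup f t))" for f :: "('v, 'k) mpol"
  have lookup_R: "Poly_Mapping.lookup (R f) t =
      (if \<forall>v\<in>V. Poly_Mapping.lookup t v = 0 then Poly_Mapping.lookup f t else 0)" for f t
  proof -
    have "Poly_Mapping.lookup (R f) t = (\<Sum>s\<in>free f. if s = t then Poly_Mapping.lookup f s else 0)"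
      by (simp add: R_def lookup_sum lookup_single when_def)
    also have "\<dots> = (if t \<in> free f then Poly_Mapping.lookup f t else 0)"
      by (simp add: free_def)
    finally show ?thesis by (simp add: free_def in_keys_iff)
  qed
  have diff: "f - R f \<in> ?P" for f
    by (auto simp: variable_ideal_def in_keys_iff lookup_minus lookup_R split: if_splits)
  have keysR: "\<forall>v\<in>V. Poly_Mapping.lookup t v = 0" if "t \<in> Poly_Mapping.keys (R f)" for t f
    using that by (auto simp: in_keys_iff lookup_R split: if_splits)
  have "f \<in> ?P \<or> g \<in> ?P" if fg: "f * g \<in> ?P" for f g
  proof -
    have "R f * R g = f * g + (- 1) * (g * (f - R f)) + (- 1) * (R f * (g - R g))"
      by (simp add: algebra_simps)
    moreover have "f * g + (- 1) * (g * (f - R f)) + (- 1) * (R f * (g - R g)) \<in> ?P"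
      by (intro add mult fg diff)
    ultimately have "R f * R g \<in> ?P" by simp
    moreover have "\<forall>v\<in>V. Poly_Mapping.lookup t v = 0" if "t \<in> Poly_Mapping.keys (R f * R g)" for t
      using that keys_mult[of "R f" "R g"] keysR by (fastforce simp: lookup_add)
    ultimately have "t \<notin> Poly_Mapping.keys (R f * R g)" for t
      unfolding variable_ideal_def mem_Collect_eq by metis
    then have "Poly_Mapping.keys (R f * R g) = {}" by blast
    then have "R f * R g = 0" by simp
    then have "R f = 0 \<or> R g = 0" by simp
    then show ?thesis using diff[of f] diff[of g] by auto
  qed
  then show ?thesis using sub neq unfolding prime_ideal_def by blast
qed

lemma variable_ideal_strict_mono:
  assumes "V \<subset> W"
  shows "variable_ideal V \<subset> (variable_ideal W :: ('v, 'k::field) mpol set)"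
proof
  show "variable_ideal V \<subseteq> (variable_ideal W :: ('v, 'k) mpol set)"
    using assms by (fastforce simp: variable_ideal_def)
  obtain w where w: "w \<in> W" "w \<notin> V" using assms by blast
  let ?x = "Poly_Mapping.single (Poly_Mapping.single w 1) 1 :: ('v, 'k) mpol"
  have "?x \<in> variable_ideal W" "?x \<notin> variable_ideal V"
    using w by (auto simp: variable_ideal_def lookup_single when_def)
  then show "variable_ideal V \<noteq> (variable_ideal W :: ('v, 'k) mpol set)" by blast
qed

text \<open>
  The variable ideals of an increasing enumeration of sets of variables attain the bound on the length of chains.
\<close>

lemma krull_dim_faithful:
  fixes scale :: "('v::{finite,linorder}, 'k::field) mpol \<Rightarrow> 'b::ab_group_add \<Rightarrow> 'b"
  assumes "annihilator scale N \<subseteq> {0}"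
  shows "krull_dim scale N = enat CARD('v)"
proof -
  let ?C = "{enat l | l. \<exists>P :: nat \<Rightarrow> ('v, 'k) mpol set.
     (\<forall>i\<le>l. prime_ideal (P i) \<and> annihilator scale N \<subseteq> P i) \<and> (\<forall>i<l. P i \<subset> P (Suc i))}"
  have upper: "c \<le> enat CARD('v)" if "c \<in> ?C" for c
  proof -
    from that obtain l and P :: "nat \<Rightarrow> ('v, 'k) mpol set" where "c = enat l"
      "\<And>i. i \<le> l \<Longrightarrow> prime_ideal (P i)" "\<And>i. i < l \<Longrightarrow> P i \<subset> P (Suc i)"
      by blast
    then show ?thesis using prime_chain_length_le[of l P] by simp
  qed
  obtain h :: "nat \<Rightarrow> 'v" where h: "bij_betw h {..<CARD('v)} UNIV"
    using ex_bij_betw_nat_finite[of "UNIV :: 'v set"] by (auto simp: atLeast0LessThan)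
  let ?P = "\<lambda>i. variable_ideal (h ` {..<i}) :: ('v, 'k) mpol set"
  have "?P i \<subset> ?P (Suc i)" if "i < CARD('v)" for i
  proof (rule variable_ideal_strict_mono)
    have "h i \<notin> h ` {..<i}"
    proof
      assume "h i \<in> h ` {..<i}"
      then obtain i' where "i' < i" "h i = h i'" by auto
      then show False using that bij_betw_imp_inj_on[OF h] by (auto dest!: inj_onD)
    qed
    then show "h ` {..<i} \<subset> h ` {..<Suc i}" by (auto simp: lessThan_Suc)
  qed
  moreover have "prime_ideal (?P i) \<and> annihilator scale N \<subseteq> ?P i" for i
    using assms prime_variable_ideal prime_idealD(1)[OF prime_variable_ideal] by blast
  ultimately have "enat CARD('v) \<in> ?C"
    by (intro CollectI exI[of _ "CARD('v)"] exI[of _ ?P] conjI refl) auto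
  then show ?thesis unfolding krull_dim_def using upper by (intro antisym Sup_least Sup_upper) auto
qed

section \<open>Hilbert functions and polynomials of the strands\<close>

lemma lookup_incl_exponent:
  "Poly_Mapping.lookup (incl_exponent t) (Inl r) = Poly_Mapping.lookup t r"
  by (auto simp: incl_exponent_def lookup_sum lookup_single when_def in_keys_iff)

lemma incl_exponent_eq_iff: "incl_exponent t = incl_exponent u \<longleftrightarrow> t = u"
  by (metis lookup_incl_exponent poly_mapping_eqI)

lemma incl_pol_const_pol: "incl_pol (const_pol c) = const_pol c"
  by (cases "c = 0") (auto simp: incl_pol_def const_pol_def incl_exponent_def)

text \<open>
  Multiplication by a monomial shifts the exponents injectively. Together with the injectivity of
  \<open>incl_exponent\<close> this makes the submodule generated by a monomial of \<open>A\<close> free over \<open>S\<close>.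
\<close>

lemma incl_pol_mult_monomial_eq_0:
  fixes f :: "('n, 'k::comm_ring_1) mpol" and u :: "'n + 'm \<Rightarrow>\<^sub>0 nat"
  assumes "incl_pol f * Poly_Mapping.single u 1 = 0"
  shows "f = 0"
proof (rule poly_mapping_eqI)
  fix t
  have "0 = Poly_Mapping.lookup (incl_pol f * Poly_Mapping.single u 1) (incl_exponent t + u)"
    by (simp add: assms)
  also have "\<dots> = (\<Sum>s\<in>Poly_Mapping.keys f. if s = t then Poly_Mapping.lookup f s else 0)"
    by (simp add: incl_pol_def sum_distrib_right mult_single lookup_sum lookup_single when_def
        incl_exponent_eq_iff)
  also have "\<dots> = Poly_Mapping.lookup f t" by (simp add: in_keys_iff)
  finally show "Poly_Mapping.lookup f t = Poly_Mapping.lookup 0 t" by simp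
qed

lemma annihilator_restrict_scalars:
  assumes "Poly_Mapping.single u 1 \<in> N"
  shows "annihilator (restrict_scalars (*) :: ('n, 'k::comm_ring_1) mpol \<Rightarrow> ('n + 'm, 'k) mpol \<Rightarrow> _) N \<subseteq> {0}"
  using assms incl_pol_mult_monomial_eq_0 by (fastforce simp: annihilator_def restrict_scalars_def)

lemma strand_eq:
  "strand (bi_twist a b (A_comp p)) k i = {f. Poly_Mapping.keys f \<subseteq> {t. bideg p t = (i - a, k - b)}}"
  by (auto simp: strand_def bi_twist_def A_comp_def)

text \<open>
  The Hilbert function of a standard graded polynomial ring in \<open>q \<ge> 1\<close> variables.
\<close>

definition standard_hilbert :: "nat \<Rightarrow> int \<Rightarrow> nat" where
  "standard_hilbert q z = (if z < 0 then 0 else (nat z + q - 1) choose (q - 1))"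

lemma card_functions_sum:
  "card {\<alpha> :: 'n::finite \<Rightarrow> nat. int (sum \<alpha> UNIV) = z} = standard_hilbert CARD('n) z"
proof (cases "z < 0")
  case True
  then have "{\<alpha> :: 'n::finite \<Rightarrow> nat. int (sum \<alpha> UNIV) = z} = {}"
    by (auto simp flip: of_nat_sum)
  then show ?thesis using True by (simp add: standard_hilbert_def)
next
  case False
  then have "{\<alpha> :: 'n::finite \<Rightarrow> nat. int (sum \<alpha> UNIV) = z} = compositions UNIV (nat z)"
    by (auto simp: compositions_def simp flip: of_nat_sum)
  then show ?thesis using False card_compositions[of "UNIV :: 'n set" "nat z"]
    by (simp add: standard_hilbert_def)
qed

text \<open>
  An exponent vector of \<open>A\<close> is a pair of a \<open>y\<close>-part \<open>\<beta>\<close> and an \<open>x\<close>-part. The bidegree prescribes the sum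
  of \<open>\<beta>\<close> and then, once \<open>\<beta>\<close> is chosen, the sum of the \<open>x\<close>-part.
\<close>

lemma card_bideg:
  fixes p :: "'m::finite \<Rightarrow> nat"
  shows "finite {t :: 'n::finite + 'm \<Rightarrow>\<^sub>0 nat. bideg p t = (z, int K)}"
    and "card {t :: 'n + 'm \<Rightarrow>\<^sub>0 nat. bideg p t = (z, int K)} =
      (\<Sum>\<beta>\<in>compositions UNIV K. standard_hilbert CARD('n) (z - int (\<Sum>s\<in>UNIV. p s * \<beta> s)))"
proof -
  let ?T = "{t :: 'n + 'm \<Rightarrow>\<^sub>0 nat. bideg p t = (z, int K)}"
  let ?A = "\<lambda>\<beta>. {\<alpha> :: 'n \<Rightarrow> nat. int (sum \<alpha> UNIV) = z - int (\<Sum>s\<in>UNIV. p s * \<beta> s)}"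
  let ?f = "\<lambda>t :: 'n + 'm \<Rightarrow>\<^sub>0 nat. (\<lambda>s. Poly_Mapping.lookup t (Inr s), \<lambda>r. Poly_Mapping.lookup t (Inl r))"
  let ?g = "\<lambda>(\<beta>, \<alpha>). Abs_poly_mapping (case_sum \<alpha> \<beta>) :: 'n + 'm \<Rightarrow>\<^sub>0 nat"
  have bij: "bij_betw ?f ?T (SIGMA \<beta>:compositions UNIV K. ?A \<beta>)"
  proof (rule bij_betw_byWitness[where f' = ?g])
    show "\<forall>t\<in>?T. ?g (?f t) = t"
      by (auto intro!: poly_mapping_eqI split: sum.split)
    show "\<forall>y\<in>(SIGMA \<beta>:compositions UNIV K. ?A \<beta>). ?f (?g y) = y" by auto
    show "?f ` ?T \<subseteq> (SIGMA \<beta>:compositions UNIV K. ?A \<beta>)"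
      by (auto simp: bideg_def compositions_def simp flip: of_nat_sum)
    show "?g ` (SIGMA \<beta>:compositions UNIV K. ?A \<beta>) \<subseteq> ?T"
      by (auto simp: bideg_def compositions_def simp flip: of_nat_sum)
  qed
  have finA: "finite (?A \<beta>)" for \<beta>
  proof (rule finite_subset)
    show "?A \<beta> \<subseteq> compositions UNIV (nat (z - int (\<Sum>s\<in>UNIV. p s * \<beta> s)))"
      by (auto simp: compositions_def simp flip: of_nat_sum)
  qed (simp add: finite_compositions)
  have fin: "finite (compositions (UNIV :: 'm set) K)" by (simp add: finite_compositions)
  show "finite ?T" using bij_betw_finite[OF bij] fin finA by auto
  show "card ?T = (\<Sum>\<beta>\<in>compositions UNIV K. standard_hilbert CARD('n) (z - int (\<Sum>s\<in>UNIV. p s * \<beta> s)))"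
    using bij_betw_same_card[OF bij] fin finA
    by (simp add: card_SigmaI card_functions_sum del: of_nat_sum of_nat_mult)
qed

text \<open>
  Adjoining a variable of degree one to a polynomial ring sums up its Hilbert function. The lower end
  \<open>a\<close> is arbitrary below the shift \<open>c\<close>, so one interval serves for summands with different shifts.
\<close>

lemma sum_standard_hilbert:
  assumes "a \<le> c" "q \<ge> 1"
  shows "(\<Sum>j\<in>{a..k}. standard_hilbert q (j - c)) = standard_hilbert (Suc q) (k - c)"
proof (cases "k < c")
  case True
  then show ?thesis by (auto simp: standard_hilbert_def)
next
  case False
  obtain r where q: "q = Suc r" using assms(2) by (cases q) auto
  define N where "N = nat (k - c)"
  have N: "k = c + int N" using False by (simp add: N_def)
  have "(\<Sum>j\<in>{a..k}. standard_hilbert q (j - c)) = (\<Sum>j\<in>{c..k}. standard_hilbert q (j - c))"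
    using assms(1) by (intro sum.mono_neutral_right) (auto simp: standard_hilbert_def)
  also have "\<dots> = (\<Sum>l\<le>N. standard_hilbert q (int l))"
    by (rule sum.reindex_bij_witness[of _ "\<lambda>l. c + int l" "\<lambda>j. nat (j - c)"]) (auto simp: N)
  also have "\<dots> = (\<Sum>l\<le>N. (r + l) choose r)"
    by (simp add: standard_hilbert_def q add.commute)
  also have "\<dots> = standard_hilbert (Suc q) (k - c)"
    unfolding choose_rising_sum(1) by (simp add: standard_hilbert_def q N add.commute)
  finally show ?thesis .
qed

text \<open>
  The strand is the direct sum of the free modules \<open>S(-(a + p \<cdot> \<beta>))\<close>, and each summation of the Hilbert
  function acts as adjoining one more variable of degree one to \<open>S\<close>. All summands vanish in degrees below
  \<open>a\<close>, because the weights are nonnegative; this makes the infinite sums finite.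
\<close>

lemma iterated_hilbert_strand:
  fixes p :: "'m::finite \<Rightarrow> nat"
  assumes "b \<le> k"
  shows "iterated_hilbert (restrict_scalars (*) :: ('n::finite, 'k::field) mpol \<Rightarrow> ('n + 'm, 'k) mpol \<Rightarrow> _)
      (strand (bi_twist a b (A_comp p)) k) r i =
    (\<Sum>\<beta>\<in>compositions UNIV (nat (k - b)).
        standard_hilbert (CARD('n) + r) (i - a - int (\<Sum>s\<in>UNIV. p s * \<beta> s)))"
proof (induction r arbitrary: i)
  case 0
  have scale: "(\<lambda>c. restrict_scalars (*) (const_pol c :: ('n, 'k) mpol)) =
      (\<lambda>c (f :: ('n + 'm, 'k) mpol). const_pol c * f)"
    by (simp add: fun_eq_iff restrict_scalars_def incl_pol_const_pol)
  show ?case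
    unfolding iterated_hilbert.simps scale strand_eq
    using assms card_bideg[where p = p and z = "i - a" and K = "nat (k - b)" and 'n = 'n]
    by (subst dim_mpol_supported) (simp_all add: diff_diff_eq del: of_nat_sum of_nat_mult)
next
  case (Suc r)
  let ?h = "iterated_hilbert (restrict_scalars (*) :: ('n, 'k) mpol \<Rightarrow> ('n + 'm, 'k) mpol \<Rightarrow> _)
      (strand (bi_twist a b (A_comp p)) k) r"
  let ?w = "\<lambda>\<beta>. int (\<Sum>s\<in>UNIV. p s * \<beta> s)"
  have zero: "?h j = 0" if "j < a" for j
    unfolding Suc
  proof (rule sum.neutral, rule ballI)
    fix \<beta> :: "'m \<Rightarrow> nat"
    have "j - a - ?w \<beta> < 0" using that by linarith
    then show "standard_hilbert (CARD('n) + r) (j - a - ?w \<beta>) = 0" by (simp add: standard_hilbert_def)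
  qed
  have "(\<Sum>j | j \<le> i \<and> ?h j \<noteq> 0. ?h j) = (\<Sum>j\<in>{a..i}. ?h j)"
    using zero by (intro sum.mono_neutral_left) (auto simp: not_less[symmetric])
  also have "\<dots> = (\<Sum>\<beta>\<in>compositions UNIV (nat (k - b)). \<Sum>j\<in>{a..i}.
      standard_hilbert (CARD('n) + r) (j - (a + ?w \<beta>)))"
    unfolding Suc by (subst sum.swap) (simp add: diff_diff_eq)
  also have "\<dots> = (\<Sum>\<beta>\<in>compositions UNIV (nat (k - b)).
      standard_hilbert (CARD('n) + Suc r) (i - a - ?w \<beta>))"
  proof (rule sum.cong)
    fix \<beta> :: "'m \<Rightarrow> nat"
    have "CARD('n) + r \<ge> 1" by (simp add: Suc_leI)
    then show "(\<Sum>j\<in>{a..i}. standard_hilbert (CARD('n) + r) (j - (a + ?w \<beta>))) =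
        standard_hilbert (CARD('n) + Suc r) (i - a - ?w \<beta>)"
      using sum_standard_hilbert[of a "a + ?w \<beta>" "CARD('n) + r" i]
      by (simp add: diff_diff_eq del: of_nat_sum of_nat_mult)
  qed simp
  finally show ?case by simp
qed

lemma poly_eqI_eventually_int:
  fixes P Q :: "rat poly"
  assumes "\<forall>\<^sub>F k in at_top. poly P (of_int k) = poly Q (of_int k)"
  shows "P = Q"
proof (rule ccontr)
  assume "P \<noteq> Q"
  then have "finite {x. poly (P - Q) x = 0}" by (intro poly_roots_finite) simp
  moreover obtain N :: int where N: "\<And>k. k \<ge> N \<Longrightarrow> poly P (of_int k) = poly Q (of_int k)"
    using assms unfolding eventually_at_top_linorder by blast
  then have "rat_of_int ` {N..} \<subseteq> {x. poly (P - Q) x = 0}" by auto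
  ultimately have "finite (rat_of_int ` {N..})" using finite_subset by blast
  then have "finite {N..}" by (rule finite_imageD) (simp add: inj_on_def)
  then show False using infinite_Ici by blast
qed

text \<open>
  The Hilbert function agrees with its polynomial as soon as the degree is at least every shift
  \<open>a + p \<cdot> \<beta>\<close>, of which there are finitely many.
\<close>

lemma poly_iterated_hilbert_poly_strand:
  fixes p :: "'m::finite \<Rightarrow> nat"
  assumes "b \<le> k"
  shows "poly (iterated_hilbert_poly
      (restrict_scalars (*) :: ('n::finite, 'k::field) mpol \<Rightarrow> ('n + 'm, 'k) mpol \<Rightarrow> _)
      (strand (bi_twist a b (A_comp p)) k) r) x =
    (\<Sum>\<beta>\<in>compositions UNIV (nat (k - b)).
        (x - (of_int a + of_nat (\<Sum>s\<in>UNIV. p s * \<beta> s)) + of_nat (CARD('n) + r - 1)) gchoose (CARD('n) + r - 1))"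
proof -
  let ?w = "\<lambda>\<beta>. \<Sum>s\<in>UNIV. p s * \<beta> s"
  let ?C = "compositions (UNIV :: 'm set) (nat (k - b))"
  let ?q = "CARD('n) + r"
  let ?h = "iterated_hilbert (restrict_scalars (*) :: ('n, 'k) mpol \<Rightarrow> ('n + 'm, 'k) mpol \<Rightarrow> _)
      (strand (bi_twist a b (A_comp p)) k) r"
  obtain B :: "rat poly" where B: "\<And>x. poly B x = x gchoose (?q - 1)" using gbinomial_poly by blast
  define P where "P = (\<Sum>\<beta>\<in>?C. pcompose B [: of_nat (?q - 1) - (of_int a + of_nat (?w \<beta>)), 1 :])"
  have P: "poly P x = (\<Sum>\<beta>\<in>?C. (x - (of_int a + of_nat (?w \<beta>)) + of_nat (?q - 1)) gchoose (?q - 1))" for x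
    by (simp add: P_def poly_sum poly_pcompose B algebra_simps del: of_nat_sum of_nat_mult of_nat_add)
  have "\<forall>\<^sub>F i in at_top. \<forall>\<beta>\<in>?C. i \<ge> a + int (?w \<beta>)"
    by (intro eventually_ball_finite finite_compositions ballI eventually_ge_at_top) simp
  then have ev: "\<forall>\<^sub>F i in at_top. of_nat (?h i) = poly P (of_int i)"
  proof (rule eventually_mono)
    fix i assume i: "\<forall>\<beta>\<in>?C. i \<ge> a + int (?w \<beta>)"
    have "of_nat (standard_hilbert ?q (i - a - int (?w \<beta>))) =
        (of_int i - (of_int a + of_nat (?w \<beta>)) + of_nat (?q - 1) :: rat) gchoose (?q - 1)" if "\<beta> \<in> ?C" for \<beta>
    proof -
      define N where "N = nat (i - a - int (?w \<beta>))"
      have N: "i = a + int (?w \<beta>) + int N" using bspec[OF i that] unfolding N_def by linarith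
      have "?q \<ge> 1" by (simp add: Suc_leI)
      then have "of_nat (standard_hilbert ?q (i - a - int (?w \<beta>))) = (of_nat (N + (?q - 1)) :: rat) gchoose (?q - 1)"
        by (simp add: N standard_hilbert_def binomial_gbinomial del: of_nat_sum of_nat_mult of_nat_add)
      then show ?thesis by (simp add: N algebra_simps del: of_nat_sum of_nat_mult)
    qed
    then show "of_nat (?h i) = poly P (of_int i)"
      unfolding iterated_hilbert_strand[OF assms] P of_nat_sum[of _ ?C] by (intro sum.cong) auto
  qed
  have "iterated_hilbert_poly (restrict_scalars (*) :: ('n, 'k) mpol \<Rightarrow> ('n + 'm, 'k) mpol \<Rightarrow> _)
      (strand (bi_twist a b (A_comp p)) k) r = P"
    unfolding iterated_hilbert_poly_def
  proof (rule the_equality)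
    show "\<forall>\<^sub>F i in at_top. of_nat (?h i) = poly P (of_int i)" by (rule ev)
    fix Q :: "rat poly" assume "\<forall>\<^sub>F i in at_top. of_nat (?h i) = poly Q (of_int i)"
    with ev have "\<forall>\<^sub>F i in at_top. poly Q (of_int i) = poly P (of_int i)"
      by eventually_elim simp
    then show "Q = P" by (rule poly_eqI_eventually_int)
  qed
  then show ?thesis using P by simp
qed

section \<open>Iterated Hilbert coefficients of the strands\<close>

lemma gbinomial_add_self: "(x + of_nat k) gchoose k = (- 1) ^ k * ((- x - 1) gchoose k)" for x :: rat
  using gbinomial_negated_upper[of "x + of_nat k" k] by simp

text \<open>
  After negating the upper arguments this is Vandermonde's identity for \<open>c + (- x - 1)\<close>. In terms of
  generating series it is the expansion of \<open>t ^ c\<close> in powers of \<open>1 - t\<close>.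
\<close>

lemma shifted_gbinomial_expansion:
  fixes x c :: rat
  assumes "q \<ge> 1"
  shows "(x - c + of_nat (q - 1)) gchoose (q - 1) =
    (\<Sum>j<q. (- 1) ^ j * (c gchoose j) * ((x + of_nat (q - j - 1)) gchoose (q - j - 1)))"
proof -
  obtain N where q: "q = Suc N" using assms by (cases q) auto
  have "(\<Sum>j<q. (- 1) ^ j * (c gchoose j) * ((x + of_nat (q - j - 1)) gchoose (q - j - 1))) =
      (\<Sum>j\<le>N. (- 1) ^ N * ((c gchoose j) * ((- x - 1) gchoose (N - j))))"
    unfolding q lessThan_Suc_atMost
  proof (rule sum.cong)
    fix j assume "j \<in> {..N}"
    then have "(- 1 :: rat) ^ N = (- 1) ^ j * (- 1) ^ (N - j)" by (simp flip: power_add)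
    moreover have "Suc N - j - 1 = N - j" by simp
    ultimately show "(- 1) ^ j * (c gchoose j) * ((x + of_nat (Suc N - j - 1)) gchoose (Suc N - j - 1)) =
        (- 1) ^ N * ((c gchoose j) * ((- x - 1) gchoose (N - j)))"
      by (simp only: gbinomial_add_self) (simp add: mult_ac)
  qed simp
  also have "\<dots> = (- 1) ^ N * ((c - x - 1) gchoose N)"
    using gbinomial_Vandermonde[of c "- x - 1" N]
    by (simp add: sum_distrib_left[symmetric] atLeast0AtMost diff_diff_eq add.commute diff_add_eq[symmetric] add_diff_eq)
  also have "\<dots> = (x - c + of_nat N) gchoose N"
    using gbinomial_add_self[of "x - c" N] by (simp add: algebra_simps)
  finally show ?thesis by (simp add: q)
qed

text \<open>
  At \<open>x = - N - 1\<close> the polynomial with lower index \<open>i\<close> takes the value \<open>(- 1) ^ i * (N choose i)\<close>, which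
  vanishes for \<open>i > N\<close>. Evaluation at \<open>N = 0, 1, \<dots>\<close> therefore gives a triangular system.
\<close>

lemma shifted_gbinomials_independent:
  fixes d :: "nat \<Rightarrow> rat"
  assumes "\<And>x. (\<Sum>j<q. d j * ((x + of_nat (q - j - 1)) gchoose (q - j - 1))) = 0" "j < q"
  shows "d j = 0"
proof -
  define D where "D i = d (q - Suc i)" for i
  have sum0: "(\<Sum>i<q. D i * ((x + of_nat i) gchoose i)) = 0" for x
  proof -
    have "(\<Sum>i<q. D i * ((x + of_nat i) gchoose i)) =
        (\<Sum>j<q. D (q - Suc j) * ((x + of_nat (q - Suc j)) gchoose (q - Suc j)))"
      by (rule sum.nat_diff_reindex[symmetric])
    also have "\<dots> = (\<Sum>j<q. d j * ((x + of_nat (q - j - 1)) gchoose (q - j - 1)))"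
      by (intro sum.cong) (auto simp: D_def Suc_diff_Suc)
    finally show ?thesis using assms(1) by simp
  qed
  have D0: "D N = 0" if "N < q" for N
    using that
  proof (induction N rule: less_induct)
    case (less N)
    have "0 = (\<Sum>i<q. D i * ((- of_nat N - 1 + of_nat i) gchoose i))" using sum0 by simp
    also have "\<dots> = (\<Sum>i<q. D i * ((- 1) ^ i * of_nat (N choose i)))"
      by (simp add: gbinomial_add_self binomial_gbinomial)
    also have "\<dots> = (\<Sum>i\<in>{N}. D i * ((- 1) ^ i * of_nat (N choose i)))"
    proof (rule sum.mono_neutral_right)
      show "\<forall>i\<in>{..<q} - {N}. D i * ((- 1) ^ i * of_nat (N choose i)) = 0"
      proof
        fix i assume "i \<in> {..<q} - {N}"
        then consider "i < N" | "N < i" by fastforce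
        then show "D i * ((- 1) ^ i * of_nat (N choose i)) = 0"
          using less by cases auto
      qed
    qed (use less in auto)
    finally show ?case by simp
  qed
  show ?thesis using D0[of "q - Suc j"] assms(2) by (simp add: D_def)
qed

lemma total_module_component: "w \<in> W i \<Longrightarrow> w \<in> total_module W"
  unfolding total_module_def by (intro CollectI exI[of _ "{i}"] exI[of _ "\<lambda>_. w"]) auto

text \<open>
  The strand contains a power of a \<open>y\<close>-variable, which no nonzero element of \<open>S\<close> annihilates.
\<close>

lemma krull_dim_strand:
  fixes p :: "'m::finite \<Rightarrow> nat"
  assumes "b \<le> k"
  shows "krull_dim (restrict_scalars (*) :: ('n::{finite,linorder}, 'k::field) mpol \<Rightarrow> ('n + 'm, 'k) mpol \<Rightarrow> _)
      (total_module (strand (bi_twist a b (A_comp p)) k)) = enat CARD('n)"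
proof -
  obtain s :: 'm where True by blast
  define u :: "'n + 'm \<Rightarrow>\<^sub>0 nat" where "u = Poly_Mapping.single (Inr s) (nat (k - b))"
  have "snd (bideg p u) = k - b"
    using assms by (simp add: bideg_def u_def lookup_single when_def flip: of_nat_sum)
  then have "Poly_Mapping.single u 1 \<in> strand (bi_twist a b (A_comp p)) k (fst (bideg p u) + a)"
    unfolding strand_eq by (simp add: prod_eq_iff)
  then have "Poly_Mapping.single u 1 \<in> total_module (strand (bi_twist a b (A_comp p)) k)"
    by (rule total_module_component)
  then show ?thesis by (intro krull_dim_faithful annihilator_restrict_scalars)
qed

text \<open>
  Summing \<open>shifted_gbinomial_expansion\<close> over all shifts \<open>c = a + p \<cdot> \<beta>\<close> exhibits the coefficients;
  independence of the binomial basis makes them the unique choice.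
\<close>

lemma iterated_hilbert_coeff_strand:
  fixes p :: "'m::finite \<Rightarrow> nat"
  assumes "b \<le> k" "j < CARD('n) + r"
  shows "of_int (iterated_hilbert_coeff
      (restrict_scalars (*) :: ('n::{finite,linorder}, 'k::field) mpol \<Rightarrow> ('n + 'm, 'k) mpol \<Rightarrow> _)
      (strand (bi_twist a b (A_comp p)) k) r j) =
    weighted_binomial_sum p UNIV (of_int a) j (nat (k - b))"
proof -
  let ?scale = "restrict_scalars (*) :: ('n, 'k) mpol \<Rightarrow> ('n + 'm, 'k) mpol \<Rightarrow> _"
  let ?W = "strand (bi_twist a b (A_comp p)) k"
  let ?w = "\<lambda>\<beta>. \<Sum>s\<in>UNIV. p s * \<beta> s"
  let ?C = "compositions (UNIV :: 'm set) (nat (k - b))"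
  let ?E = "\<lambda>j. weighted_binomial_sum p UNIV (of_int a) j (nat (k - b))"
  define q where "q = CARD('n) + r"
  have q: "q \<ge> 1" by (simp add: q_def Suc_leI)
  have "\<exists>z. of_int z = ?E j" for j
  proof -
    have "(of_int a + of_nat (?w \<beta>) :: rat) gchoose j \<in> \<int>" for \<beta>
      using of_int_gbinomial[of "a + int (?w \<beta>)" j, where 'a = rat, symmetric]
      by (simp del: of_nat_sum of_nat_mult)
    then have "?E j \<in> \<int>" unfolding weighted_binomial_sum_def by (intro Ints_sum) auto
    then show ?thesis by (metis Ints_cases)
  qed
  then obtain z where z: "\<And>j. of_int (z j) = ?E j" by metis
  define e where "e j = (if j < q then z j else 0)" for j
  let ?expands = "\<lambda>e. (\<forall>j\<ge>q. e j = 0) \<and>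
        (\<forall>x :: rat. poly (iterated_hilbert_poly ?scale ?W r) x =
           (\<Sum>j<q. (-1) ^ j * of_int (e j :: int) * ((x + of_nat (q - j - 1)) gchoose (q - j - 1))))"
  have "poly (iterated_hilbert_poly ?scale ?W r) x =
      (\<Sum>j<q. (-1) ^ j * of_int (e j) * ((x + of_nat (q - j - 1)) gchoose (q - j - 1)))" for x
  proof -
    have "poly (iterated_hilbert_poly ?scale ?W r) x =
        (\<Sum>\<beta>\<in>?C. \<Sum>j<q. (- 1) ^ j * ((of_int a + of_nat (?w \<beta>)) gchoose j) *
            ((x + of_nat (q - j - 1)) gchoose (q - j - 1)))"
      unfolding poly_iterated_hilbert_poly_strand[OF assms(1)] q_def[symmetric]
      by (intro sum.cong shifted_gbinomial_expansion q refl)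
    also have "\<dots> = (\<Sum>j<q. (-1) ^ j * of_int (e j) * ((x + of_nat (q - j - 1)) gchoose (q - j - 1)))"
      by (subst sum.swap)
        (simp add: e_def z weighted_binomial_sum_def sum_distrib_left sum_distrib_right
          del: of_nat_sum of_nat_mult of_nat_diff)
    finally show ?thesis .
  qed
  then have e: "?expands e" by (simp add: e_def)
  have "e' = e" if e': "?expands e'" for e'
  proof
    fix j
    show "e' j = e j"
    proof (cases "j < q")
      case True
      have "(- 1) ^ j * of_int (e' j - e j) = (0 :: rat)"
      proof (rule shifted_gbinomials_independent[OF _ True])
        fix x :: rat
        have "(\<Sum>j<q. (-1) ^ j * of_int (e' j) * ((x + of_nat (q - j - 1)) gchoose (q - j - 1))) =
            (\<Sum>j<q. (-1) ^ j * of_int (e j) * ((x + of_nat (q - j - 1)) gchoose (q - j - 1)))"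
          using e e' by metis
        then show "(\<Sum>j<q. (-1) ^ j * of_int (e' j - e j) * ((x + of_nat (q - j - 1)) gchoose (q - j - 1))) = 0"
          by (simp add: algebra_simps sum_subtractf)
      qed
      then show ?thesis by simp
    qed (use e e' in auto)
  qed
  with e have "(THE e. ?expands e) = e" by (intro the_equality)
  then have "iterated_hilbert_coeff ?scale ?W r = e"
    unfolding iterated_hilbert_coeff_def krull_dim_strand[OF assms(1)] the_enat.simps Let_def q_def .
  then show ?thesis using assms(2) by (simp add: e_def z q_def)
qed

theorem proposition1p5:
  fixes p :: "'m::{finite,linorder} \<Rightarrow> nat" and a b :: int
    and n m p\<^sub>m :: nat
    and S_action :: "('n::{finite,linorder}, 'k::field) mpol \<Rightarrow> ('n + 'm, 'k) mpol \<Rightarrow> ('n + 'm, 'k) mpol"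
    and e :: "nat \<Rightarrow> nat \<Rightarrow> int \<Rightarrow> int"
    and bound :: "nat \<Rightarrow> int \<Rightarrow> rat"
  assumes n_def: "n = CARD('n)" and m_def: "m = CARD('m)"
    and p_last: "p\<^sub>m = p (Max UNIV)" and p_le: "\<forall>s. p s \<le> p\<^sub>m"
    and S_action_def: "S_action = restrict_scalars (*)"
    and e_def: "\<forall>i j k. e i j k =
          iterated_hilbert_coeff S_action (strand (bi_twist a b (A_comp p)) k) i j"
    and bound_def: "\<forall>j k. bound j k =
          (of_int (k - b + int m - 1) gchoose (m - 1)) * (of_int (int p\<^sub>m * (k - b) + a) gchoose j)"
  shows
    "(\<forall>i. \<forall>j \<le> n + i - 1. \<exists>Q :: rat poly.
        (\<forall>\<^sub>F k in at_top. of_int (e i j k) = poly Q (of_int k)) \<and>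
        degree Q \<le> m + j - 1 \<and>
        (p\<^sub>m > 0 \<or> j = 0 \<longrightarrow> degree Q = m + j - 1))
     \<and> (\<forall>i. \<forall>\<^sub>F k in at_top. \<forall>j \<le> n + i - 1. of_int (e i j k) \<le> bound j k)
     \<and> (\<forall>i. \<forall>\<^sub>F k in at_top. \<forall>j \<le> n + i - 1.
          j \<ge> 1 \<longrightarrow> (of_int (e i j k) = bound j k \<longleftrightarrow> (\<forall>s s'. p s = p s')))
     \<and> ((\<forall>i. \<forall>\<^sub>F k in at_top. \<forall>j \<le> n + i - 1. of_int (e i j k) = bound j k) \<longleftrightarrow> (\<forall>s s'. p s = p s'))"
proof -
  define E where "E j k = weighted_binomial_sum p UNIV (of_int a) j (nat (k - b))" for j k
  have n1: "n \<ge> 1" by (simp add: n_def Suc_leI)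
  \<comment> \<open>Since \<open>n \<ge> 1\<close>, the range \<open>j \<le> n + i - 1\<close> is exactly \<open>j < n + i\<close> despite truncated subtraction.\<close>
  have e: "of_int (e i j k) = E j k" if "k \<ge> b" "j \<le> n + i - 1" for i j k
  proof -
    have "j < CARD('n) + i" using that(2) n1 n_def by linarith
    then show ?thesis
      unfolding E_def e_def[rule_format] S_action_def
      using iterated_hilbert_coeff_strand[OF that(1)] by blast
  qed
  have bound: "bound j k = of_nat (card (compositions (UNIV :: 'm set) (nat (k - b)))) *
      (of_int (int p\<^sub>m * int (nat (k - b)) + a) gchoose j)" if "k \<ge> b" for j k
  proof -
    have m1: "m \<ge> 1" by (simp add: m_def Suc_leI)
    have "k - b + int m - 1 = int (nat (k - b) + m - 1)" using that m1 by simp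
    then have "(of_int (k - b + int m - 1) :: rat) gchoose (m - 1) =
        of_nat (card (compositions (UNIV :: 'm set) (nat (k - b))))"
      by (simp only: card_compositions[OF finite UNIV_not_empty] m_def[symmetric] binomial_gbinomial of_int_of_nat_eq)
    then show ?thesis using that by (simp add: bound_def)
  qed
  have large: "int j + 2 * \<bar>a\<bar> \<le> int (nat (k - b))" "k \<ge> b"
    if "k \<ge> b + int (n + i) + 2 * \<bar>a\<bar>" "j \<le> n + i - 1" for i j k
    using that by linarith+
  have ev: "\<forall>\<^sub>F k in at_top. k \<ge> b + int (n + i) + 2 * \<bar>a\<bar>" for i
    by (rule eventually_ge_at_top)
  have polynomial: "\<exists>Q :: rat poly. (\<forall>\<^sub>F k in at_top. of_int (e i j k) = poly Q (of_int k)) \<and>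
        degree Q \<le> m + j - 1 \<and> (p\<^sub>m > 0 \<or> j = 0 \<longrightarrow> degree Q = m + j - 1)"
    if j: "j \<le> n + i - 1" for i j
  proof -
    obtain Q :: "rat poly" where Q: "\<And>k. k \<ge> b \<Longrightarrow> E j k = poly Q (of_int k)"
      "degree Q \<le> m + j - 1" "j = 0 \<or> (\<exists>s. p s > 0) \<longrightarrow> degree Q = m + j - 1"
      using weighted_binomial_sum_polynomial[of b p "of_int a" j] unfolding E_def m_def by blast
    have "\<forall>\<^sub>F k in at_top. of_int (e i j k) = poly Q (of_int k)"
      using eventually_ge_at_top[of b] by (rule eventually_mono) (metis e j Q(1))
    then show ?thesis using Q(2,3) p_last by blast
  qed
  have le: "of_int (e i j k) \<le> bound j k"
    if "k \<ge> b + int (n + i) + 2 * \<bar>a\<bar>" "j \<le> n + i - 1" for i j k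
    using weighted_binomial_sum_le[of p p\<^sub>m j a "nat (k - b)"] p_le large[OF that] that(2)
    by (simp add: e bound E_def)
  have eq_if: "of_int (e i j k) = bound j k"
    if "\<forall>s s'. p s = p s'" "k \<ge> b" "j \<le> n + i - 1" for i j k
    using weighted_binomial_sum_const[of p p\<^sub>m a j "nat (k - b)"] that p_last
    by (simp add: e bound E_def)
  have only_if: "\<forall>s s'. p s = p s'"
    if eq: "of_int (e i j k) = bound j k" and k: "k \<ge> b + int (n + i) + 2 * \<bar>a\<bar>"
      and j: "j \<le> n + i - 1" "1 \<le> j" for i j k
  proof (rule ccontr)
    assume "\<not> (\<forall>s s'. p s = p s')"
    then obtain s where "p s \<noteq> p\<^sub>m" by metis
    then have "p s < p\<^sub>m" using p_le le_neq_implies_less by blast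
    then show False
      using weighted_binomial_sum_less[of p p\<^sub>m j a "nat (k - b)" s] p_le large[OF k j(1)] j eq
      by (simp add: e bound E_def)
  qed
  have iff: "\<forall>\<^sub>F k in at_top. \<forall>j \<le> n + i - 1. j \<ge> 1 \<longrightarrow>
      (of_int (e i j k) = bound j k \<longleftrightarrow> (\<forall>s s'. p s = p s'))" for i
    using ev[of i]
  proof (rule eventually_mono)
    fix k assume k: "k \<ge> b + int (n + i) + 2 * \<bar>a\<bar>"
    then have "k \<ge> b" by linarith
    then show "\<forall>j \<le> n + i - 1. j \<ge> 1 \<longrightarrow>
        (of_int (e i j k) = bound j k \<longleftrightarrow> (\<forall>s s'. p s = p s'))"
      using eq_if only_if k by metis
  qed
  have all_iff: "(\<forall>i. \<forall>\<^sub>F k in at_top. \<forall>j \<le> n + i - 1. of_int (e i j k) = bound j k) \<longleftrightarrow>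
      (\<forall>s s'. p s = p s')" (is "?L \<longleftrightarrow> ?R")
  proof
    assume ?R
    then show ?L
      using eq_if by (intro allI eventually_mono[OF eventually_ge_at_top[of b]]) blast
  next
    assume ?L
    \<comment> \<open>The choice \<open>i = 1\<close> makes \<open>j = 1\<close> admissible for every \<open>n \<ge> 1\<close>; at \<open>j = 0\<close> equality does not depend on the weights.\<close>
    then have "\<forall>\<^sub>F k in at_top. \<forall>j \<le> n + 1 - 1. of_int (e 1 j k) = bound j k" ..
    then have "\<forall>\<^sub>F k in at_top. of_int (e 1 1 k) = bound 1 k \<and> k \<ge> b + int (n + 1) + 2 * \<bar>a\<bar>"
      using ev[of 1] by eventually_elim (use n1 in simp)
    then obtain k where "of_int (e 1 1 k) = bound 1 k" "k \<ge> b + int (n + 1) + 2 * \<bar>a\<bar>"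
      using eventually_happens'[OF trivial_limit_at_top_linorder] by blast
    then show ?R using only_if[of 1 1 k] n1 by simp
  qed
  have "\<forall>\<^sub>F k in at_top. \<forall>j \<le> n + i - 1. of_int (e i j k) \<le> bound j k" for i
    using ev[of i] by (rule eventually_mono) (use le in blast)
  then show ?thesis using polynomial iff all_iff by blast
qed

end
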